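(* Let $\epsilon_0=0.10$, $(\check r_\alpha,\check r_\omega,\check r_c)=(0.0594,\,0.0260,\,0.4929)$ and $\rho=0.3191$. For all $0<\epsilon\le\epsilon_0$ there exists a unique point $\hat x_\epsilon=(\hat\alpha_\epsilon,\hat\omega_\epsilon,\hat c_\epsilon)\in\mathbb{R}^2\times\ell^K_0$ satisfying $F_\epsilon(\hat x_\epsilon)=0$ and $$|\hat\alpha_\epsilon-\bar\alpha_\epsilon|<\check r_\alpha\epsilon^2,\quad |\hat\omega_\epsilon-\bar\omega_\epsilon|<\check r_\omega\epsilon^2,\quad \|\hat c_\epsilon-\bar c_\epsilon\|<\check r_c\epsilon^2,\quad \|K^{-1}\hat c_\epsilon\|<\rho.$$ Furthermore, $\hat\alpha_\epsilon>\tfrac{\pi}{2}$ for $0<\epsilon<\epsilon_0$.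
   Context: $\ell^1$ is the space of complex sequences $a=\{a_k\}_{k\ge1}$ with norm $\|a\|:=2\sum_{k\ge1}|a_k|<\infty$; such $a$ is identified with a bi-infinite sequence via $a_0=0$, $a_{-k}=\overline{a_k}$. $\ell^1_0:=\{a\in\ell^1:a_1=0\}$. Operators on $\ell^1$: $[Ka]_k=k^{-1}a_k$, $[U_\omega a]_k=e^{-ik\omega}a_k$, $[\sigma^-a]_k=a_{k+1}$, $[\sigma^+a]_k=a_{k-1}$ (with $a_0=0$), $L_\omega=\sigma^+(e^{-i\omega}I+U_\omega)+\sigma^-(e^{i\omega}I+U_\omega)$. $\ell^K_0:=\{a\in\ell^1_0:K^{-1}a\in\ell^1\}$. Convolution: $[a*b]_k=\sum_{k_1+k_2=k,\,k_1,k_2\in\mathbb{Z}}a_{k_1}b_{k_2}$ for $k\ge1$. $\mathrm{e}_j$ is the sequence with $1$ in position $j$ and $0$ elsewhere. For $\epsilon\ge0$, $(\alpha,\omega,c)\in\mathbb{R}^2\times\ell^K_0$, $$F_\epsilon(\alpha,\omega,c):=[i\omega+\alpha e^{-i\omega}]\mathrm{e}_1+(i\omega K^{-1}+\alpha U_\omega)c+\epsilon\alpha e^{-i\omega}\mathrm{e}_2+\alpha\epsilon L_\omega c+\alpha\epsilon[U_\omega c]*c\in\ell^1.$$ The approximate solution is $\bar\alpha_\epsilon=\tfrac{\pi}{2}+\tfrac{\epsilon^2}{5}(\tfrac{3\pi}{2}-1)$, $\bar\omega_\epsilon=\tfrac{\pi}{2}-\tfrac{\epsilon^2}{5}$, $\bar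 c_\epsilon=\tfrac{2-i}{5}\epsilon\,\mathrm{e}_2$. *)

theory Defs
  imports "HOL-Analysis.Analysis"
begin

text \<open>
  A one-sided sequence \<open>(a_k)\<close>, \<open>k \<ge> 1\<close>, is a function on \<^typ>\<open>nat\<close> whose value at the
  extra index 0 is required to be 0. This is the convention \<open>a_0 = 0\<close> of the bi-infinite
  extension, and it makes equality of functions coincide with equality of sequences.
\<close>

definition ell1 :: "(nat \<Rightarrow> complex) set" where
  "ell1 = {a. a 0 = 0 \<and> (\<lambda>k. cmod (a k)) summable_on {1..}}"

definition ell1_norm :: "(nat \<Rightarrow> complex) \<Rightarrow> real" where
  "ell1_norm a = 2 * (\<Sum>\<^sub>\<infinity>k\<in>{1..}. cmod (a k))"

definition ell1_0 :: "(nat \<Rightarrow> complex) set" where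
  "ell1_0 = {a \<in> ell1. a 1 = 0}"

definition bi_ext :: "(nat \<Rightarrow> complex) \<Rightarrow> int \<Rightarrow> complex" where
  "bi_ext a k = (if k > 0 then a (nat k) else if k = 0 then 0 else cnj (a (nat (- k))))"

definition opK :: "(nat \<Rightarrow> complex) \<Rightarrow> nat \<Rightarrow> complex" where
  "opK a k = a k / of_nat k"

definition opK_inv :: "(nat \<Rightarrow> complex) \<Rightarrow> nat \<Rightarrow> complex" where
  "opK_inv a k = of_nat k * a k"

lemma opK_inv_opK: "a 0 = 0 \<Longrightarrow> opK_inv (opK a) = a"
  by (rule ext) (auto simp: opK_def opK_inv_def)

lemma opK_opK_inv: "a 0 = 0 \<Longrightarrow> opK (opK_inv a) = a"
  by (rule ext) (auto simp: opK_def opK_inv_def)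

definition ellK_0 :: "(nat \<Rightarrow> complex) set" where
  "ellK_0 = {a \<in> ell1_0. opK_inv a \<in> ell1}"

definition opU :: "real \<Rightarrow> (nat \<Rightarrow> complex) \<Rightarrow> nat \<Rightarrow> complex" where
  "opU \<omega> a k = exp (- \<i> * of_nat k * of_real \<omega>) * a k"

definition shift_minus :: "(nat \<Rightarrow> complex) \<Rightarrow> nat \<Rightarrow> complex" where
  "shift_minus a k = (if k = 0 then 0 else a (k + 1))"

definition shift_plus :: "(nat \<Rightarrow> complex) \<Rightarrow> nat \<Rightarrow> complex" where
  "shift_plus a k = (if k \<le> 1 then 0 else a (k - 1))"

definition opL :: "real \<Rightarrow> (nat \<Rightarrow> complex) \<Rightarrow> nat \<Rightarrow> complex" where
  "opL \<omega> a k =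
     shift_plus (\<lambda>j. exp (- \<i> * of_real \<omega>) * a j + opU \<omega> a j) k +
     shift_minus (\<lambda>j. exp (\<i> * of_real \<omega>) * a j + opU \<omega> a j) k"

definition conv :: "(nat \<Rightarrow> complex) \<Rightarrow> (nat \<Rightarrow> complex) \<Rightarrow> nat \<Rightarrow> complex" where
  "conv a b k =
     (if k = 0 then 0
      else \<Sum>\<^sub>\<infinity>(k1, k2)\<in>{(k1, k2). k1 + k2 = int k}. bi_ext a k1 * bi_ext b k2)"

definition unit_seq :: "nat \<Rightarrow> nat \<Rightarrow> complex" where
  "unit_seq j k = (if k = j then 1 else 0)"

definition F_op :: "real \<Rightarrow> real \<times> real \<times> (nat \<Rightarrow> complex) \<Rightarrow> nat \<Rightarrow> complex" where
  "F_op \<epsilon> = (\<lambda>(\<alpha>, \<omega>, c) k.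
     (\<i> * of_real \<omega> + of_real \<alpha> * exp (- \<i> * of_real \<omega>)) * unit_seq 1 k
     + (\<i> * of_real \<omega> * opK_inv c k + of_real \<alpha> * opU \<omega> c k)
     + of_real \<epsilon> * of_real \<alpha> * exp (- \<i> * of_real \<omega>) * unit_seq 2 k
     + of_real \<alpha> * of_real \<epsilon> * opL \<omega> c k
     + of_real \<alpha> * of_real \<epsilon> * conv (opU \<omega> c) c k)"

definition alpha_bar :: "real \<Rightarrow> real" where
  "alpha_bar \<epsilon> = pi / 2 + \<epsilon>\<^sup>2 / 5 * (3 * pi / 2 - 1)"

definition omega_bar :: "real \<Rightarrow> real" where
  "omega_bar \<epsilon> = pi / 2 - \<epsilon>\<^sup>2 / 5"

definition c_bar :: "real \<Rightarrow> nat \<Rightarrow> complex" where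
  "c_bar \<epsilon> k = (2 - \<i>) / 5 * of_real \<epsilon> * unit_seq 2 k"

end

theory Submission
  imports Defs
begin

text \<open>
  After division by \<open>\<alpha>\<close> the equation \<open>F_\<epsilon> = 0\<close> only involves \<open>\<omega>\<close>, \<open>\<beta> = \<omega> / \<alpha>\<close> and \<open>c\<close>. Its first
  component reads \<open>\<i>\<beta> + exp (- \<i>\<omega>) + \<epsilon> g_1 = 0\<close> and determines \<open>cos \<omega>\<close> and \<open>\<beta>\<close>; its component
  \<open>k \<ge> 2\<close> reads \<open>(\<i>k\<beta> + exp (- \<i>k\<omega>)) c_k = - \<epsilon> g_k\<close>, where dividing by the diagonal factor gains
  the weight \<open>1 / k\<close>. Hence the equation is a fixed point problem \<open>x = T x\<close> in the norm
  \<open>\<parallel>K\<inverse> c\<parallel>\<close>, in which even \<open>\<omega> \<mapsto> U_\<omega> c\<close> is Lipschitz, and for \<open>\<epsilon> \<le> 1/10\<close> the map \<open>T\<close> contracts a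
  box that contains all the candidates. This gives uniqueness and the existence of a fixed point
  in the box. That the fixed point is close enough to the approximate solution follows by
  bootstrapping: bounds on \<open>|c_2|\<close>, \<open>|c_3|\<close>, the tail of \<open>c\<close>, \<open>|\<omega> - \<pi>/2|\<close> and \<open>|\<beta> - 1|\<close> are fed
  back into the equations for these quantities until they are sharp to the next order in \<open>\<epsilon>\<close>.
\<close>

section \<open>The sequence space\<close>

text \<open>The approximate solution is the expansion at \<omega> = \<pi>/2, \<beta> = 1. There
  component 2 reads (2i - 1) c_2 = i \<epsilon> to leading order, so c_2 = (2 - i) \<epsilon> / 5.
  Then g_1 is about (i - 1) c_2 = (-1 + 3i) \<epsilon> / 5, and component 1 gives cos \<omega> =
  \<epsilon>^2 / 5 and \<beta> = 1 - 3 \<epsilon>^2 / 5; expanding \<alpha> = \<omega> / \<beta>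
  yields \<open>alpha_bar\<close>. The contraction lives in a box of fixed size and says nothing
  about orders in \<epsilon>, whereas the radii of the theorem are tight: component 3 alone puts
  about 0.316 \<epsilon>^2 into the norm of c - c_bar, out of 0.4929 \<epsilon>^2 allowed, and at
  \<epsilon> = 1/10 the bounds for the remaining terms nearly exhaust the difference. Two
  cancellations make the estimates sharp enough: the quadratic interaction of component 2 with
  itself reaches, among k \<ge> 1, only k = 4, and the coupling of component 3 into component 4
  vanishes at \<omega> = \<pi>/2.\<close>

lemma ell1_norm_nonneg: "0 \<le> ell1_norm a"
  by (simp add: ell1_norm_def infsum_nonneg)

lemma ell1_zero_index: "a \<in> ell1 \<Longrightarrow> a 0 = 0"
  by (simp add: ell1_def)

lemma ell1_summable: "a \<in> ell1 \<Longrightarrow> (\<lambda>k. cmod (a k)) summable_on {1..}"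
  by (simp add: ell1_def)

lemma ell1_has_sum:
  assumes "a \<in> ell1"
  shows "((\<lambda>k. cmod (a k)) has_sum (ell1_norm a / 2)) {1..}"
  using has_sum_infsum[OF ell1_summable[OF assms]] by (simp add: ell1_norm_def)

lemma sum_le_ell1_norm:
  assumes "a \<in> ell1" "finite F" "F \<subseteq> {1..}"
  shows "2 * (\<Sum>k\<in>F. cmod (a k)) \<le> ell1_norm a"
  using finite_sum_le_infsum[OF ell1_summable[OF assms(1)] assms(2,3)]
  by (simp add: ell1_norm_def)

lemma norm_le_ell1_norm:
  assumes "a \<in> ell1"
  shows "2 * cmod (a k) \<le> ell1_norm a"
proof (cases "k = 0")
  case True
  with assms show ?thesis by (simp add: ell1_zero_index ell1_norm_nonneg)
next
  case False
  with sum_le_ell1_norm[OF assms, of "{k}"] show ?thesis by simp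
qed

text \<open>Comparison is the source of most memberships and norm bounds below. The sum runs over k
  \<ge> 1, so the value at index 0 is a separate premise and domination is asked from 1 on
  only.\<close>

lemma ell1_dominated:
  assumes b: "b \<in> ell1" and a: "a 0 = 0"
    and le: "\<And>k. 1 \<le> k \<Longrightarrow> cmod (a k) \<le> C * cmod (b k)"
  shows "a \<in> ell1" "ell1_norm a \<le> C * ell1_norm b"
proof -
  have s: "((\<lambda>k. C * cmod (b k)) has_sum (C * (ell1_norm b / 2))) {1..}"
    by (rule has_sum_cmult_right[OF ell1_has_sum[OF b]])
  have "(\<lambda>k. cmod (a k)) summable_on {1..}"
    by (rule summable_on_comparison_test[OF has_sum_imp_summable[OF s]]) (use le in auto)
  with a show m: "a \<in> ell1" by (simp add: ell1_def)
  show "ell1_norm a \<le> C * ell1_norm b"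
    using has_sum_mono[OF ell1_has_sum[OF m] s] le by auto
qed

lemma ell1_add:
  assumes a: "a \<in> ell1" and b: "b \<in> ell1"
  shows "(\<lambda>k. a k + b k) \<in> ell1"
    and "ell1_norm (\<lambda>k. a k + b k) \<le> ell1_norm a + ell1_norm b"
proof -
  have s: "((\<lambda>k. cmod (a k) + cmod (b k)) has_sum (ell1_norm a / 2 + ell1_norm b / 2)) {1..}"
    by (rule has_sum_add[OF ell1_has_sum[OF a] ell1_has_sum[OF b]])
  have "(\<lambda>k. cmod (a k + b k)) summable_on {1..}"
    by (rule summable_on_comparison_test[OF has_sum_imp_summable[OF s]])
      (auto simp: norm_triangle_ineq)
  then show m: "(\<lambda>k. a k + b k) \<in> ell1"
    using a b by (simp add: ell1_def)
  show "ell1_norm (\<lambda>k. a k + b k) \<le> ell1_norm a + ell1_norm b"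
    using has_sum_mono[OF ell1_has_sum[OF m] s] by (auto simp: norm_triangle_ineq)
qed

lemma ell1_cmult:
  assumes "a \<in> ell1"
  shows "(\<lambda>k. z * a k) \<in> ell1" "ell1_norm (\<lambda>k. z * a k) \<le> cmod z * ell1_norm a"
  using ell1_dominated[OF assms, of "\<lambda>k. z * a k" "cmod z"] assms
  by (auto simp: norm_mult ell1_zero_index)

lemma ell1_norm_uminus: "ell1_norm (\<lambda>k. - a k) = ell1_norm a"
  by (simp add: ell1_norm_def)

lemma ell1_norm_minus_commute: "ell1_norm (\<lambda>k. a k - b k) = ell1_norm (\<lambda>k. b k - a k)"
  by (simp add: ell1_norm_def norm_minus_commute)

lemma ell1_diff:
  assumes "a \<in> ell1" "b \<in> ell1"
  shows "(\<lambda>k. a k - b k) \<in> ell1"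
    and "ell1_norm (\<lambda>k. a k - b k) \<le> ell1_norm a + ell1_norm b"
  using ell1_add[OF assms(1) ell1_cmult(1)[OF assms(2), of "-1"]]
  by (simp_all add: ell1_norm_uminus)

lemma ell1_norm_eq_0:
  assumes "a \<in> ell1" "ell1_norm a = 0"
  shows "a = (\<lambda>k. 0)"
  using norm_le_ell1_norm[OF assms(1)] assms(2) by (auto simp: fun_eq_iff)

lemma ell1_unit:
  assumes "1 \<le> j"
  shows "(\<lambda>k. z * unit_seq j k) \<in> ell1" "ell1_norm (\<lambda>k. z * unit_seq j k) = 2 * cmod z"
proof -
  have "((\<lambda>k. cmod (z * unit_seq j k)) has_sum cmod z) {j}"
    by (rule has_sum_finiteI) (auto simp: unit_seq_def)
  then have s: "((\<lambda>k. cmod (z * unit_seq j k)) has_sum cmod z) {1..}"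
    by (subst has_sum_cong_neutral[where S="{1..}" and T="{j}"])
      (use assms in \<open>auto simp: unit_seq_def\<close>)
  then show "(\<lambda>k. z * unit_seq j k) \<in> ell1"
    using assms by (auto simp: ell1_def unit_seq_def intro: has_sum_imp_summable)
  show "ell1_norm (\<lambda>k. z * unit_seq j k) = 2 * cmod z"
    using infsumI[OF s] by (simp add: ell1_norm_def)
qed

lemma ell1_shift_plus:
  assumes a: "a \<in> ell1"
  shows "shift_plus a \<in> ell1" "ell1_norm (shift_plus a) = ell1_norm a"
proof -
  have bij: "bij_betw (\<lambda>k. k - 1) {2..} {1::nat..}"
    by (rule bij_betwI[of _ _ _ "\<lambda>k. k + 1"]) auto
  have "((\<lambda>k. cmod (a (k - 1))) has_sum (ell1_norm a / 2)) {2..}"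
    using ell1_has_sum[OF a] by (rule has_sum_reindex_bij_betw[OF bij, THEN iffD2])
  then have s: "((\<lambda>k. cmod (shift_plus a k)) has_sum (ell1_norm a / 2)) {1..}"
    by (subst has_sum_cong_neutral[where S="{1..}" and T="{2..}"]) (auto simp: shift_plus_def)
  then show "shift_plus a \<in> ell1"
    by (auto simp: ell1_def shift_plus_def intro: has_sum_imp_summable)
  show "ell1_norm (shift_plus a) = ell1_norm a"
    using infsumI[OF s] by (simp add: ell1_norm_def)
qed

text \<open>Only an inequality, unlike \<open>ell1_shift_plus\<close>: the entry at index 1 is
  lost.\<close>

lemma ell1_shift_minus:
  assumes a: "a \<in> ell1"
  shows "shift_minus a \<in> ell1" "ell1_norm (shift_minus a) \<le> ell1_norm a"
proof -
  have bij: "bij_betw (\<lambda>k. k + 1) {1..} {2::nat..}"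
    by (rule bij_betwI[of _ _ _ "\<lambda>k. k - 1"]) auto
  have a2: "(\<lambda>k. cmod (a k)) summable_on {2..}"
    by (rule summable_on_subset[OF ell1_summable[OF a]]) auto
  have s: "((\<lambda>k. cmod (a (k + 1))) has_sum (infsum (\<lambda>k. cmod (a k)) {2..})) {1..}"
    using has_sum_infsum[OF a2] by (rule has_sum_reindex_bij_betw[OF bij, THEN iffD2])
  then have s: "((\<lambda>k. cmod (shift_minus a k)) has_sum (infsum (\<lambda>k. cmod (a k)) {2..})) {1..}"
    by (subst has_sum_cong[where g = "\<lambda>k. cmod (a (k + 1))"]) (auto simp: shift_minus_def)
  then show "shift_minus a \<in> ell1"
    by (auto simp: ell1_def shift_minus_def intro: has_sum_imp_summable)
  have "infsum (\<lambda>k. cmod (a k)) {2..} \<le> infsum (\<lambda>k. cmod (a k)) {1..}"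
    by (rule infsum_mono2[OF a2 ell1_summable[OF a]]) auto
  then show "ell1_norm (shift_minus a) \<le> ell1_norm a"
    using infsumI[OF s] by (simp add: ell1_norm_def)
qed

section \<open>Phases and their dependence on the frequency\<close>

lemma norm_opU: "cmod (opU \<omega> a k) = cmod (a k)"
  by (simp add: opU_def norm_mult norm_exp_eq_Re)

lemma ell1_opU:
  assumes "a \<in> ell1"
  shows "opU \<omega> a \<in> ell1" "ell1_norm (opU \<omega> a) = ell1_norm a"
  using assms by (auto simp: ell1_def ell1_norm_def norm_opU) (simp add: opU_def)

lemma opU_diff: "opU \<omega> (\<lambda>k. a k - b k) = (\<lambda>k. opU \<omega> a k - opU \<omega> b k)"
  by (simp add: opU_def fun_eq_iff algebra_simps)

lemma norm_exp_i_diff: "cmod (exp (\<i> * of_real x) - exp (\<i> * of_real y)) \<le> \<bar>x - y\<bar>"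
proof -
  have e: "exp (\<i> * of_real x) - exp (\<i> * of_real y)
      = exp (\<i> * of_real y) * (exp (\<i> * of_real (x - y)) - 1)"
    by (simp add: right_diff_distrib exp_add[symmetric] algebra_simps)
  have "cmod (exp (\<i> * of_real x) - exp (\<i> * of_real y)) = cmod (exp (\<i> * of_real (x - y)) - 1)"
    unfolding e norm_mult by (simp add: norm_exp_eq_Re)
  also have "\<dots> = 2 * \<bar>sin ((x - y) / 2)\<bar>"
    using dist_exp_i_1[of "x - y"] by (simp add: mult.commute)
  also have "\<dots> \<le> \<bar>x - y\<bar>"
    using abs_sin_x_le_abs_x[of "(x - y) / 2"] by simp
  finally show ?thesis .
qed

lemma norm_exp_minus_diff:
  "cmod (exp (- \<i> * of_nat k * of_real x) - exp (- \<i> * of_nat k * of_real y)) \<le> k * \<bar>x - y\<bar>"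
proof -
  have "cmod (exp (\<i> * of_real (- (k * x))) - exp (\<i> * of_real (- (k * y)))) \<le> \<bar>- (k * x) - - (k * y)\<bar>"
    by (rule norm_exp_i_diff)
  also have "- (k * x) - - (k * y) = k * (y - x)"
    by (simp add: right_diff_distrib)
  also have "\<bar>k * (y - x)\<bar> = k * \<bar>x - y\<bar>"
    by (simp add: abs_mult abs_minus_commute)
  finally show ?thesis by (simp add: mult.assoc)
qed

lemma opK_inv_diff: "opK_inv (\<lambda>k. a k - b k) = (\<lambda>k. opK_inv a k - opK_inv b k)"
  by (simp add: opK_inv_def fun_eq_iff algebra_simps)

text \<open>Differentiating the k-th phase in \<omega> costs a factor k, so the Lipschitz constant
  is the norm of \<open>opK_inv a\<close>, not that of \<open>a\<close>.\<close>

lemma ell1_opU_lipschitz: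
  assumes a: "opK_inv a \<in> ell1"
  shows "(\<lambda>k. opU x a k - opU y a k) \<in> ell1"
    and "ell1_norm (\<lambda>k. opU x a k - opU y a k) \<le> \<bar>x - y\<bar> * ell1_norm (opK_inv a)"
proof -
  have le: "cmod (opU x a k - opU y a k) \<le> \<bar>x - y\<bar> * cmod (opK_inv a k)" for k
  proof -
    have "cmod (opU x a k - opU y a k)
        = cmod (exp (- \<i> * of_nat k * of_real x) - exp (- \<i> * of_nat k * of_real y)) * cmod (a k)"
      by (simp add: opU_def norm_mult[symmetric] left_diff_distrib)
    also have "\<dots> \<le> (k * \<bar>x - y\<bar>) * cmod (a k)"
      by (rule mult_right_mono[OF norm_exp_minus_diff]) simp
    finally show ?thesis by (simp add: opK_inv_def norm_mult mult_ac)
  qed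
  have "opU x a 0 - opU y a 0 = 0"
    by (simp add: opU_def)
  from ell1_dominated[OF a this le] show "(\<lambda>k. opU x a k - opU y a k) \<in> ell1"
    and "ell1_norm (\<lambda>k. opU x a k - opU y a k) \<le> \<bar>x - y\<bar> * ell1_norm (opK_inv a)"
    by auto
qed

lemma ell1_of_opK_inv:
  assumes "opK_inv a \<in> ell1" "a 0 = 0"
  shows "a \<in> ell1"
proof -
  have "cmod (a k) \<le> 1 * cmod (opK_inv a k)" if "1 \<le> k" for k
    using that mult_right_mono[of 1 "real k" "cmod (a k)"] by (simp add: opK_inv_def norm_mult)
  from ell1_dominated(1)[OF assms this] show ?thesis by simp
qed

text \<open>The smallest weight present is 2 because \<open>a 1 = 0\<close>. The contraction
  estimate relies on the factor gained here.\<close>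

lemma ell1_norm_le_opK_inv:
  assumes "opK_inv a \<in> ell1" "a 0 = 0" "a 1 = 0"
  shows "2 * ell1_norm a \<le> ell1_norm (opK_inv a)"
proof -
  have "cmod (a k) \<le> 1/2 * cmod (opK_inv a k)" if "1 \<le> k" for k
  proof (cases "k = 1")
    case False
    with that have "2 \<le> real k" by auto
    then have "2 * cmod (a k) \<le> k * cmod (a k)" by (rule mult_right_mono) simp
    then show ?thesis by (simp add: opK_inv_def norm_mult)
  qed (use assms in auto)
  from ell1_dominated(2)[OF assms(1,2) this] show ?thesis by simp
qed

section \<open>Convolution and the shift operator\<close>

lemma bi_ext_uminus: "cmod (bi_ext a (- j)) = cmod (bi_ext a j)"
  by (cases j rule: linorder_cases[of _ 0]) (auto simp: bi_ext_def)

lemma bi_ext_int: "a 0 = 0 \<Longrightarrow> bi_ext a (int k) = a k"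
  by (simp add: bi_ext_def)

lemma bi_ext_diff: "bi_ext (\<lambda>k. a k - b k) j = bi_ext a j - bi_ext b j"
  by (simp add: bi_ext_def)

lemma bij_betw_int_pos: "bij_betw int {1..} {1..}"
  by (rule bij_betwI[of _ _ _ nat]) auto

text \<open>The factor 2 in \<open>ell1_norm\<close> is explained by this: both half-lines carry the
  same mass and index 0 carries none.\<close>

lemma bi_ext_has_sum:
  assumes a: "a \<in> ell1"
  shows "((\<lambda>j. cmod (bi_ext a j)) has_sum ell1_norm a) UNIV"
proof -
  have "((\<lambda>k. cmod (bi_ext a (int k))) has_sum (ell1_norm a / 2)) {1..}"
    using ell1_has_sum[OF a] by (simp add: bi_ext_int ell1_zero_index[OF a])
  then have pos: "((\<lambda>j. cmod (bi_ext a j)) has_sum (ell1_norm a / 2)) {1..}"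
    by (rule has_sum_reindex_bij_betw[OF bij_betw_int_pos, THEN iffD1])
  have bij: "bij_betw uminus {1..} {..(-1)::int}"
    by (rule bij_betwI[of _ _ _ uminus]) auto
  have "((\<lambda>j. cmod (bi_ext a (- j))) has_sum (ell1_norm a / 2)) {1..}"
    using pos by (simp add: bi_ext_uminus)
  then have neg: "((\<lambda>j. cmod (bi_ext a j)) has_sum (ell1_norm a / 2)) {..-1}"
    by (rule has_sum_reindex_bij_betw[OF bij, THEN iffD1])
  have "((\<lambda>j. cmod (bi_ext a j)) has_sum (ell1_norm a / 2 + ell1_norm a / 2)) ({1..} \<union> {..-1})"
    by (rule has_sum_Un_disjoint[OF pos neg]) auto
  then show ?thesis
    by (subst has_sum_cong_neutral[where T = "{1..} \<union> {..-1}"]) (auto simp: bi_ext_def)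
qed

text \<open>The convolution of the moduli, taken at every integer and not only at k \<ge> 1: the
  product formula for the total mass and the evenness in k need the whole line.\<close>

definition abs_conv :: "(nat \<Rightarrow> complex) \<Rightarrow> (nat \<Rightarrow> complex) \<Rightarrow> int \<Rightarrow> real" where
  "abs_conv a b k = (\<Sum>\<^sub>\<infinity>j. cmod (bi_ext a j) * cmod (bi_ext b (k - j)))"

lemma abs_conv_uminus: "abs_conv a b (- k) = abs_conv a b k"
proof -
  have "abs_conv a b (- k) = (\<Sum>\<^sub>\<infinity>j. cmod (bi_ext a (- j)) * cmod (bi_ext b (- k - (- j))))"
    unfolding abs_conv_def
    by (rule infsum_reindex_bij_betw[symmetric, OF bij_uminus])
  also have "\<dots> = abs_conv a b k"
    unfolding abs_conv_def
    using bi_ext_uminus[of b "k - _"] by (intro infsum_cong) (simp add: bi_ext_uminus)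
  finally show ?thesis .
qed

lemma abs_conv_has_sum:
  assumes a: "a \<in> ell1" and b: "b \<in> ell1"
  shows "(\<lambda>j. cmod (bi_ext a j) * cmod (bi_ext b (k - j))) summable_on UNIV"
    and "(abs_conv a b has_sum (ell1_norm a * ell1_norm b)) UNIV"
proof -
  let ?f = "\<lambda>(j, i). cmod (bi_ext a j) * cmod (bi_ext b i)"
  let ?h = "\<lambda>(k, j). cmod (bi_ext a j) * cmod (bi_ext b (k - j))"
  have inner: "((\<lambda>i. ?f (j, i)) has_sum (cmod (bi_ext a j) * ell1_norm b)) UNIV" for j
    using has_sum_cmult_right[OF bi_ext_has_sum[OF b]] by simp
  have outer: "((\<lambda>j. cmod (bi_ext a j) * ell1_norm b) has_sum (ell1_norm a * ell1_norm b)) UNIV"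
    by (rule has_sum_cmult_left[OF bi_ext_has_sum[OF a]])
  have "?f summable_on (UNIV \<times> UNIV)"
    by (rule summable_on_SigmaI[OF inner has_sum_imp_summable[OF outer]]) auto
  with inner outer have "(?f has_sum (ell1_norm a * ell1_norm b)) (UNIV \<times> UNIV)"
    by (rule has_sum_SigmaI)
  \<comment> \<open>The shear regroups the absolutely convergent double sum by the output index k =
    j + i.\<close>
  moreover have "bij_betw (\<lambda>(k, j). (j, k - j)) UNIV (UNIV :: (int \<times> int) set)"
    by (rule bij_betwI[of _ _ _ "\<lambda>(j, i). (i + j, j)"]) auto
  from has_sum_reindex_bij_betw[OF this, of ?f]
  have "((\<lambda>x. ?f (case x of (k, j) \<Rightarrow> (j, k - j))) has_sum s) UNIV = (?f has_sum s) UNIV" for s .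
  ultimately have h: "(?h has_sum (ell1_norm a * ell1_norm b)) (UNIV \<times> UNIV)"
    by (simp add: case_prod_unfold)
  show sm: "(\<lambda>j. cmod (bi_ext a j) * cmod (bi_ext b (k - j))) summable_on UNIV" for k
    by (rule summable_on_SigmaD1[OF has_sum_imp_summable[OF h]]) simp
  show "(abs_conv a b has_sum (ell1_norm a * ell1_norm b)) UNIV"
    using has_sum_SigmaD[OF h, of "abs_conv a b"] has_sum_infsum[OF sm]
    by (simp add: abs_conv_def)
qed

lemma conv_eq_infsum:
  assumes "k \<noteq> 0"
  shows "conv a b k = (\<Sum>\<^sub>\<infinity>j. bi_ext a j * bi_ext b (int k - j))"
proof -
  have "bij_betw (\<lambda>j. (j, int k - j)) UNIV {(k1, k2). k1 + k2 = int k}"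
    by (rule bij_betwI[of _ _ _ fst]) auto
  from infsum_reindex_bij_betw[OF this, of "\<lambda>(k1, k2). bi_ext a k1 * bi_ext b k2"] assms
  show ?thesis by (simp add: conv_def)
qed

lemma conv_summable:
  assumes "a \<in> ell1" "b \<in> ell1"
  shows "(\<lambda>j. bi_ext a j * bi_ext b (k - j)) summable_on UNIV"
  by (rule abs_summable_summable) (use abs_conv_has_sum(1)[OF assms] in \<open>simp add: norm_mult\<close>)

lemma norm_conv_le_abs_conv:
  assumes "a \<in> ell1" "b \<in> ell1" "k \<noteq> 0"
  shows "cmod (conv a b k) \<le> abs_conv a b (int k)"
  unfolding conv_eq_infsum[OF assms(3)] abs_conv_def
  using norm_infsum_bound[of "\<lambda>j. bi_ext a j * bi_ext b (int k - j)" UNIV]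
    abs_conv_has_sum(1)[OF assms(1,2)]
  by (simp add: norm_mult)

text \<open>The negative frequencies carry half of the mass of the bi-infinite convolution.\<close>
lemma ell1_conv:
  assumes a: "a \<in> ell1" and b: "b \<in> ell1"
  shows "conv a b \<in> ell1" "ell1_norm (conv a b) \<le> ell1_norm a * ell1_norm b"
proof -
  note s = abs_conv_has_sum(2)[OF a b]
  have s1: "abs_conv a b summable_on A" for A
    by (rule summable_on_subset[OF has_sum_imp_summable[OF s]]) auto
  have bij: "bij_betw uminus {1..} {..(-1)::int}"
    by (rule bij_betwI[of _ _ _ uminus]) auto
  have eq: "infsum (abs_conv a b) {..-1} = infsum (abs_conv a b) {1..}"
    using infsum_reindex_bij_betw[OF bij, of "abs_conv a b"] by (simp add: abs_conv_uminus)
  \<comment> \<open>The mass of the convolution at index 0 is dropped here.\<close>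
  have "infsum (abs_conv a b) ({1..} \<union> {..-1}) \<le> infsum (abs_conv a b) UNIV"
    by (rule infsum_mono2[OF s1 s1]) (auto simp: abs_conv_def infsum_nonneg)
  also have "infsum (abs_conv a b) ({1..} \<union> {..-1}) = 2 * infsum (abs_conv a b) {1..}"
    by (subst infsum_Un_disjoint[OF s1 s1]) (auto simp: eq)
  finally have le: "2 * infsum (abs_conv a b) {1..} \<le> ell1_norm a * ell1_norm b"
    by (simp add: infsumI[OF s])
  have t: "((\<lambda>k. abs_conv a b (int k)) has_sum (infsum (abs_conv a b) {1..})) {1..}"
    by (rule has_sum_reindex_bij_betw[OF bij_betw_int_pos, THEN iffD2, OF has_sum_infsum[OF s1]])
  have bound: "cmod (conv a b k) \<le> abs_conv a b (int k)" if "k \<in> {1..}" for k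
    by (rule norm_conv_le_abs_conv[OF a b]) (use that in auto)
  have "(\<lambda>k. cmod (conv a b k)) summable_on {1..}"
    by (rule summable_on_comparison_test[OF has_sum_imp_summable[OF t] bound]) auto
  then show m: "conv a b \<in> ell1" by (simp add: ell1_def conv_def)
  from has_sum_mono[OF ell1_has_sum[OF m] t bound] le
  show "ell1_norm (conv a b) \<le> ell1_norm a * ell1_norm b" by simp
qed

text \<open>Young's inequality for the exponents \<infinity> and 1. No factor 2 appears, since
  \<open>ell1_norm b\<close> is already the mass over all integers. It serves to bound single
  components of the quadratic term.\<close>

lemma norm_conv_le_left:
  assumes a: "a \<in> ell1" and b: "b \<in> ell1" and A: "\<And>k. cmod (a k) \<le> A"
  shows "cmod (conv a b k) \<le> A * ell1_norm b"
proof (cases "k = 0")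
  case True
  have "0 \<le> A" using A[of 0] norm_ge_zero order_trans by blast
  with True show ?thesis by (simp add: conv_def ell1_norm_nonneg)
next
  case False
  have A': "cmod (bi_ext a j) \<le> A" for j
    using order_trans[OF norm_ge_zero A[of 0]] by (simp add: bi_ext_def A)
  have bij: "bij_betw (\<lambda>j. int k - j) UNIV (UNIV :: int set)"
    by (rule bij_betwI[of _ _ _ "\<lambda>j. int k - j"]) auto
  have "((\<lambda>j. cmod (bi_ext b (int k - j))) has_sum ell1_norm b) UNIV"
    by (rule has_sum_reindex_bij_betw[OF bij, THEN iffD2, OF bi_ext_has_sum[OF b]])
  then have s: "((\<lambda>j. A * cmod (bi_ext b (int k - j))) has_sum (A * ell1_norm b)) UNIV"
    by (rule has_sum_cmult_right)
  have "abs_conv a b (int k) \<le> A * ell1_norm b"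
    unfolding abs_conv_def
    by (rule has_sum_mono[OF has_sum_infsum[OF abs_conv_has_sum(1)[OF a b, of "int k"]] s])
      (intro mult_right_mono A' norm_ge_zero)
  with norm_conv_le_abs_conv[OF a b False] show ?thesis by simp
qed

lemma norm_conv_le_right:
  assumes a: "a \<in> ell1" and b: "b \<in> ell1" and B: "\<And>k. cmod (b k) \<le> B"
  shows "cmod (conv a b k) \<le> ell1_norm a * B"
proof (cases "k = 0")
  case True
  have "0 \<le> B" using B[of 0] norm_ge_zero order_trans by blast
  with True show ?thesis by (simp add: conv_def ell1_norm_nonneg)
next
  case False
  have B': "cmod (bi_ext b j) \<le> B" for j
    using order_trans[OF norm_ge_zero B[of 0]] by (simp add: bi_ext_def B)
  have s: "((\<lambda>j. cmod (bi_ext a j) * B) has_sum (ell1_norm a * B)) UNIV"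
    by (rule has_sum_cmult_left[OF bi_ext_has_sum[OF a]])
  have "abs_conv a b (int k) \<le> ell1_norm a * B"
    unfolding abs_conv_def
    by (rule has_sum_mono[OF has_sum_infsum[OF abs_conv_has_sum(1)[OF a b, of "int k"]] s])
      (intro mult_left_mono B' norm_ge_zero)
  with norm_conv_le_abs_conv[OF a b False] show ?thesis by simp
qed

lemma conv_diff_left:
  assumes "a \<in> ell1" "a' \<in> ell1" "b \<in> ell1"
  shows "conv (\<lambda>k. a k - a' k) b k = conv a b k - conv a' b k"
proof (cases "k = 0")
  case False
  have "(\<Sum>\<^sub>\<infinity>j. bi_ext a j * bi_ext b (int k - j) + (-1) * (bi_ext a' j * bi_ext b (int k - j)))
      = (\<Sum>\<^sub>\<infinity>j. bi_ext a j * bi_ext b (int k - j))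
        + (\<Sum>\<^sub>\<infinity>j. (-1) * (bi_ext a' j * bi_ext b (int k - j)))"
    by (intro infsum_add summable_on_cmult_right conv_summable assms)
  with False show ?thesis
    by (simp add: conv_eq_infsum bi_ext_diff left_diff_distrib infsum_uminus)
qed (simp add: conv_def)

lemma conv_diff_right:
  assumes "a \<in> ell1" "b \<in> ell1" "b' \<in> ell1"
  shows "conv a (\<lambda>k. b k - b' k) k = conv a b k - conv a b' k"
proof (cases "k = 0")
  case False
  have "(\<Sum>\<^sub>\<infinity>j. bi_ext a j * bi_ext b (int k - j) + (-1) * (bi_ext a j * bi_ext b' (int k - j)))
      = (\<Sum>\<^sub>\<infinity>j. bi_ext a j * bi_ext b (int k - j))
        + (\<Sum>\<^sub>\<infinity>j. (-1) * (bi_ext a j * bi_ext b' (int k - j)))"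
    by (intro infsum_add summable_on_cmult_right conv_summable assms)
  with False show ?thesis
    by (simp add: conv_eq_infsum bi_ext_diff right_diff_distrib infsum_uminus)
qed (simp add: conv_def)

text \<open>Sums of two frequencies from {2, -2} are 0, 4 and -4 only. Hence the dominant mode does
  not feed back quadratically into components 1, 2 and 3, which gains a power of \<epsilon>
  there.\<close>

lemma conv_unit_2:
  assumes "k \<noteq> 4"
  shows "conv (\<lambda>k. x * unit_seq 2 k) (\<lambda>k. y * unit_seq 2 k) k = 0"
proof (cases "k = 0")
  case False
  have z: "bi_ext (\<lambda>k. z * unit_seq 2 k) j = 0" if "j \<noteq> 2" "j \<noteq> -2" for z j
    using that by (auto simp: bi_ext_def unit_seq_def)
  have "bi_ext (\<lambda>k. x * unit_seq 2 k) j * bi_ext (\<lambda>k. y * unit_seq 2 k) (int k - j) = 0" for j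
  proof (cases "j = 2 \<or> j = -2")
    case True
    with assms False have "int k - j \<noteq> 2" "int k - j \<noteq> -2" by auto
    from z[OF this] show ?thesis by simp
  qed (use z[of j] in auto)
  then show ?thesis
    unfolding conv_eq_infsum[OF False] by (intro infsum_0)
qed (simp add: conv_def)

section \<open>The linear coupling L\<close>

lemma opL_eq:
  "opL \<omega> a = (\<lambda>k. (shift_plus (\<lambda>j. exp (- \<i> * of_real \<omega>) * a j) k + shift_plus (opU \<omega> a) k)
     + (shift_minus (\<lambda>j. exp (\<i> * of_real \<omega>) * a j) k + shift_minus (opU \<omega> a) k))"
  by (simp add: opL_def shift_plus_def shift_minus_def fun_eq_iff)

lemma ell1_opL:
  assumes a: "a \<in> ell1"
  shows "opL \<omega> a \<in> ell1" "ell1_norm (opL \<omega> a) \<le> 4 * ell1_norm a"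
proof -
  have e: "cmod (exp (- \<i> * of_real \<omega>)) = 1" "cmod (exp (\<i> * of_real \<omega>)) = 1"
    by (simp_all add: norm_exp_eq_Re)
  note c1 = ell1_cmult[OF a, of "exp (- \<i> * of_real \<omega>)", unfolded e]
  note c2 = ell1_cmult[OF a, of "exp (\<i> * of_real \<omega>)", unfolded e]
  note u = ell1_opU[OF a, of \<omega>]
  note p1 = ell1_add[OF ell1_shift_plus(1)[OF c1(1)] ell1_shift_plus(1)[OF u(1)]]
  note p2 = ell1_add[OF ell1_shift_minus(1)[OF c2(1)] ell1_shift_minus(1)[OF u(1)]]
  note p = ell1_add[OF p1(1) p2(1)]
  from p(1) show "opL \<omega> a \<in> ell1" by (simp only: opL_eq)
  have "ell1_norm (opL \<omega> a) \<le> (ell1_norm a + ell1_norm a) + (ell1_norm a + ell1_norm a)"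
    unfolding opL_eq
    using p(2) p1(2) p2(2) c1(2) c2(2) u(2) ell1_shift_plus(2)[OF c1(1)]
      ell1_shift_plus(2)[OF u(1)] ell1_shift_minus(2)[OF c2(1)] ell1_shift_minus(2)[OF u(1)]
    by simp
  then show "ell1_norm (opL \<omega> a) \<le> 4 * ell1_norm a" by simp
qed

lemma opL_diff: "opL \<omega> (\<lambda>k. a k - b k) = (\<lambda>k. opL \<omega> a k - opL \<omega> b k)"
  by (simp add: opL_def shift_plus_def shift_minus_def opU_def fun_eq_iff algebra_simps)

text \<open>Of the four summands of \<open>opL\<close>, the two with constant phase cost
  \<open>ell1_norm a\<close> each, the two with \<open>opU\<close> cost
  \<open>ell1_norm (opK_inv a)\<close> each.\<close>

lemma ell1_opL_lipschitz:
  assumes a: "a \<in> ell1" and Ka: "opK_inv a \<in> ell1"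
  shows "(\<lambda>k. opL x a k - opL y a k) \<in> ell1"
    and "ell1_norm (\<lambda>k. opL x a k - opL y a k)
      \<le> \<bar>x - y\<bar> * (2 * ell1_norm a + 2 * ell1_norm (opK_inv a))"
proof -
  let ?m = "exp (- \<i> * of_real x) - exp (- \<i> * of_real y)"
  let ?p = "exp (\<i> * of_real x) - exp (\<i> * of_real y)"
  let ?u = "\<lambda>k. opU x a k - opU y a k"
  have eq: "(\<lambda>k. opL x a k - opL y a k) =
     (\<lambda>k. (shift_plus (\<lambda>j. ?m * a j) k + shift_plus ?u k)
        + (shift_minus (\<lambda>j. ?p * a j) k + shift_minus ?u k))"
    by (simp add: opL_def shift_plus_def shift_minus_def fun_eq_iff algebra_simps)
  have m: "cmod ?m * ell1_norm a \<le> \<bar>x - y\<bar> * ell1_norm a"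
    using mult_right_mono[OF norm_exp_minus_diff[of 1 x y] ell1_norm_nonneg[of a]] by simp
  have p: "cmod ?p * ell1_norm a \<le> \<bar>x - y\<bar> * ell1_norm a"
    using mult_right_mono[OF norm_exp_i_diff[of x y] ell1_norm_nonneg[of a]] by simp
  note c1 = ell1_cmult[OF a, of ?m]
  note c2 = ell1_cmult[OF a, of ?p]
  note u = ell1_opU_lipschitz[OF Ka, of x y]
  note p1 = ell1_add[OF ell1_shift_plus(1)[OF c1(1)] ell1_shift_plus(1)[OF u(1)]]
  note p2 = ell1_add[OF ell1_shift_minus(1)[OF c2(1)] ell1_shift_minus(1)[OF u(1)]]
  note ps = ell1_add[OF p1(1) p2(1)]
  from ps(1) show "(\<lambda>k. opL x a k - opL y a k) \<in> ell1" by (simp only: eq)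
  have "ell1_norm (\<lambda>k. opL x a k - opL y a k)
      \<le> (\<bar>x - y\<bar> * ell1_norm a + \<bar>x - y\<bar> * ell1_norm (opK_inv a))
        + (\<bar>x - y\<bar> * ell1_norm a + \<bar>x - y\<bar> * ell1_norm (opK_inv a))"
    unfolding eq
    using ps(2) p1(2) p2(2) c1(2) c2(2) u(2) ell1_shift_plus(2)[OF c1(1)]
      ell1_shift_plus(2)[OF u(1)] ell1_shift_minus(2)[OF c2(1)] ell1_shift_minus(2)[OF u(1)] m p
    by linarith
  then show "ell1_norm (\<lambda>k. opL x a k - opL y a k)
      \<le> \<bar>x - y\<bar> * (2 * ell1_norm a + 2 * ell1_norm (opK_inv a))"
    by (simp add: algebra_simps)
qed

section \<open>The contraction\<close>

definition diag :: "real \<Rightarrow> real \<Rightarrow> nat \<Rightarrow> complex" where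
  "diag \<omega> \<beta> k = \<i> * of_nat k * of_real \<beta> + exp (- \<i> * of_nat k * of_real \<omega>)"

text \<open>The g of the overview. All terms of \<open>F_op\<close> that carry \<epsilon> are
  collected here, with the factor \<alpha> \<epsilon> taken out; see \<open>F_op_eq\<close>.\<close>

definition nlin :: "real \<Rightarrow> (nat \<Rightarrow> complex) \<Rightarrow> nat \<Rightarrow> complex" where
  "nlin \<omega> c = (\<lambda>k. exp (- \<i> * of_real \<omega>) * unit_seq 2 k + opL \<omega> c k + conv (opU \<omega> c) c k)"

lemma ell1_nlin:
  assumes c: "c \<in> ell1"
  shows "nlin \<omega> c \<in> ell1" "ell1_norm (nlin \<omega> c) \<le> 2 + 4 * ell1_norm c + (ell1_norm c)\<^sup>2"
proof -
  note u = ell1_unit[of 2 "exp (- \<i> * of_real \<omega>)"]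
  note l = ell1_opL[OF c, of \<omega>]
  note q = ell1_conv[OF ell1_opU(1)[OF c] c, of \<omega>]
  have u1: "(\<lambda>k. exp (- \<i> * of_real \<omega>) * unit_seq 2 k) \<in> ell1"
    "ell1_norm (\<lambda>k. exp (- \<i> * of_real \<omega>) * unit_seq 2 k) = 2"
    using u by (simp_all add: norm_exp_eq_Re)
  note ul = ell1_add[OF u1(1) l(1)]
  note ulq = ell1_add[OF ul(1) q(1)]
  from ulq(1) show "nlin \<omega> c \<in> ell1" by (simp add: nlin_def)
  show "ell1_norm (nlin \<omega> c) \<le> 2 + 4 * ell1_norm c + (ell1_norm c)\<^sup>2"
    unfolding nlin_def using ulq(2) ul(2) u1(2) l(2) q(2) ell1_opU(2)[OF c, of \<omega>]
    by (simp add: power2_eq_square)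
qed

lemma ell1_nlin_lipschitz:
  assumes c: "c \<in> ell1" and d: "d \<in> ell1" and Kc: "opK_inv c \<in> ell1"
  shows "(\<lambda>k. nlin x c k - nlin y d k) \<in> ell1"
    and "ell1_norm (\<lambda>k. nlin x c k - nlin y d k)
      \<le> \<bar>x - y\<bar> * (2 + 2 * ell1_norm c + 2 * ell1_norm (opK_inv c) + ell1_norm (opK_inv c) * ell1_norm c)
        + (4 + ell1_norm c + ell1_norm d) * ell1_norm (\<lambda>k. c k - d k)"
proof -
  define e where "e = (\<lambda>k. c k - d k)"
  define z where "z = exp (- \<i> * of_real x) - exp (- \<i> * of_real y)"
  have e: "e \<in> ell1" unfolding e_def by (rule ell1_diff(1)[OF c d])
  note ne = ell1_norm_nonneg[of e]
  note U = ell1_opU_lipschitz[OF Kc, of x y]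
  note Uc = ell1_opU(1)[OF c]
  note Ud = ell1_opU(1)[OF d]
  have Ue: "opU y e \<in> ell1" "ell1_norm (opU y e) = ell1_norm e" using ell1_opU[OF e] by auto
  have zn: "cmod z \<le> \<bar>x - y\<bar>" using norm_exp_minus_diff[of 1 x y] by (simp add: z_def)
  note t1 = ell1_unit[of 2 z]
  note t2 = ell1_opL_lipschitz[OF c Kc, of x y]
  note t3 = ell1_opL[OF e, of y]
  note t4 = ell1_conv[OF U(1) c]
  note t5 = ell1_conv[OF Ue(1) c]
  note t6 = ell1_conv[OF Ud e, of y]
  \<comment> \<open>Telescoping: the frequency changes first while \<open>c\<close> is fixed, so
    that only \<open>opK_inv c\<close> enters; then the sequence changes at frequency
    \<open>y\<close>.\<close>
  have eq: "(\<lambda>k. nlin x c k - nlin y d k) =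
     (\<lambda>k. (z * unit_seq 2 k + (opL x c k - opL y c k)) + (opL y e k
        + (conv (\<lambda>k. opU x c k - opU y c k) c k + (conv (opU y e) c k + conv (opU y d) e k))))"
    unfolding e_def z_def
    by (simp add: fun_eq_iff nlin_def opL_diff opU_diff conv_diff_left[OF Uc Uc c]
        conv_diff_left[OF Uc Ud c] conv_diff_right[OF Ud c d] algebra_simps)
  have t1m: "(\<lambda>k. z * unit_seq 2 k) \<in> ell1" "ell1_norm (\<lambda>k. z * unit_seq 2 k) = 2 * cmod z"
    using t1 by simp_all
  note s1 = ell1_add[OF t1m(1) t2(1)]
  note s2 = ell1_add[OF t5(1) t6(1)]
  note s3 = ell1_add[OF t4(1) s2(1)]
  note s4 = ell1_add[OF t3(1) s3(1)]
  note s5 = ell1_add[OF s1(1) s4(1)]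
  from s5(1) show "(\<lambda>k. nlin x c k - nlin y d k) \<in> ell1" by (simp only: eq)
  have b4: "ell1_norm (conv (\<lambda>k. opU x c k - opU y c k) c)
      \<le> (\<bar>x - y\<bar> * ell1_norm (opK_inv c)) * ell1_norm c"
    using t4(2) mult_right_mono[OF U(2) ell1_norm_nonneg[of c]] by simp
  have "ell1_norm (\<lambda>k. nlin x c k - nlin y d k)
     \<le> 2 * \<bar>x - y\<bar> + \<bar>x - y\<bar> * (2 * ell1_norm c + 2 * ell1_norm (opK_inv c))
       + 4 * ell1_norm e + (\<bar>x - y\<bar> * ell1_norm (opK_inv c)) * ell1_norm c
       + ell1_norm e * ell1_norm c + ell1_norm d * ell1_norm e"
    unfolding eq
    using s5(2) s4(2) s3(2) s2(2) s1(2) t1m(2) zn t2(2) t3(2) b4 t5(2)[unfolded Ue(2)] t6(2)[unfolded ell1_opU(2)[OF d]] Ue(2)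
    by argo
  then show "ell1_norm (\<lambda>k. nlin x c k - nlin y d k)
      \<le> \<bar>x - y\<bar> * (2 + 2 * ell1_norm c + 2 * ell1_norm (opK_inv c) + ell1_norm (opK_inv c) * ell1_norm c)
        + (4 + ell1_norm c + ell1_norm d) * ell1_norm (\<lambda>k. c k - d k)"
    unfolding e_def[symmetric] by (simp add: algebra_simps)
qed

section \<open>Trigonometry near \<pi>/2\<close>

lemma cos_ge_parabola: "1 - t\<^sup>2 / 2 \<le> cos (t::real)"
proof -
  have "(sin (t / 2))\<^sup>2 \<le> (t / 2)\<^sup>2"
    using abs_sin_x_le_abs_x[of "t / 2"] by (simp only: abs_le_square_iff)
  moreover have "cos t = 1 - 2 * (sin (t / 2))\<^sup>2"
    using cos_double_sin[of "t / 2"] by simp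
  ultimately show ?thesis by (simp add: power_divide)
qed

lemma sin_near_half_pi:
  assumes "\<bar>\<omega> - pi / 2\<bar> \<le> r"
  shows "1 - r\<^sup>2 / 2 \<le> sin \<omega>"
proof -
  have "(\<omega> - pi / 2)\<^sup>2 \<le> r\<^sup>2" using assms by (simp add: abs_le_square_iff[symmetric])
  moreover have "sin \<omega> = cos (\<omega> - pi / 2)" by (simp add: cos_diff)
  ultimately show ?thesis using cos_ge_parabola[of "\<omega> - pi / 2"] by simp
qed

lemma abs_cos_near_half_pi: "\<bar>cos \<omega>\<bar> \<le> \<bar>\<omega> - pi / 2\<bar>"
proof -
  have "cos \<omega> = - sin (\<omega> - pi / 2)" by (simp add: sin_diff)
  then show ?thesis using abs_sin_x_le_abs_x[of "\<omega> - pi / 2"] by simp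
qed

text \<open>The derivative 1 - sin vanishes to second order at \<pi>/2. Thus \<omega> + cos \<omega>
  is a Newton step for cos \<omega> = 0 with the slope frozen at -1, which is why the \<omega>-entry
  of \<open>picard_step\<close> contracts.\<close>

lemma add_cos_lipschitz:
  assumes "\<bar>x - pi / 2\<bar> \<le> r" "\<bar>y - pi / 2\<bar> \<le> r"
  shows "\<bar>(x + cos x) - (y + cos y)\<bar> \<le> r\<^sup>2 / 2 * \<bar>x - y\<bar>"
proof -
  have "norm ((x + cos x) - (y + cos y)) \<le> r\<^sup>2 / 2 * norm (x - y)"
  proof (rule field_differentiable_bound[of "cball (pi / 2) r"])
    fix z assume "z \<in> cball (pi / 2) r"
    then have "\<bar>z - pi / 2\<bar> \<le> r" by (simp add: dist_real_def abs_minus_commute)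
    from sin_near_half_pi[OF this] show "norm (1 - sin z) \<le> r\<^sup>2 / 2"
      using sin_le_one[of z] by simp
    show "((\<lambda>x. x + cos x) has_field_derivative 1 - sin z) (at z within cball (pi / 2) r)"
      by (auto intro!: derivative_eq_intros)
  qed (use assms in \<open>auto simp: dist_real_def abs_minus_commute\<close>)
  then show ?thesis by simp
qed

lemma sin_lipschitz_near_half_pi:
  assumes "\<bar>x - pi / 2\<bar> \<le> r" "\<bar>y - pi / 2\<bar> \<le> r"
  shows "\<bar>sin x - sin y\<bar> \<le> r * \<bar>x - y\<bar>"
proof -
  have "norm (sin x - sin y) \<le> r * norm (x - y)"
  proof (rule field_differentiable_bound[of "cball (pi / 2) r"])
    fix z assume "z \<in> cball (pi / 2) r"
    then show "norm (cos z) \<le> r"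
      using abs_cos_near_half_pi[of z] by (simp add: dist_real_def abs_minus_commute)
    show "(sin has_field_derivative cos z) (at z within cball (pi / 2) r)"
      by (auto intro!: derivative_eq_intros)
  qed (use assms in \<open>auto simp: dist_real_def abs_minus_commute\<close>)
  then show ?thesis by simp
qed

section \<open>Size of the diagonal factor and the box\<close>

lemma norm_diag_diff: "cmod (diag x b k - diag y b' k) \<le> k * (\<bar>b - b'\<bar> + \<bar>x - y\<bar>)"
proof -
  have "diag x b k - diag y b' k = \<i> * of_nat k * of_real (b - b')
      + (exp (- \<i> * of_nat k * of_real x) - exp (- \<i> * of_nat k * of_real y))"
    by (simp add: diag_def algebra_simps)
  also have "cmod \<dots> \<le> cmod (\<i> * of_nat k * of_real (b - b')) + k * \<bar>x - y\<bar>"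
    by (rule norm_triangle_le) (use norm_exp_minus_diff[of k x y] in simp)
  also have "cmod (\<i> * of_nat k * of_real (b - b')) = k * \<bar>b - b'\<bar>"
    unfolding norm_mult norm_of_real by simp
  finally show ?thesis by (simp add: algebra_simps)
qed

lemma norm_diag_ge: "k * \<beta> - 1 \<le> cmod (diag \<omega> \<beta> k)"
proof -
  have "cmod (\<i> * of_nat k * of_real \<beta>) - cmod (exp (- \<i> * of_nat k * of_real \<omega>)) \<le> cmod (diag \<omega> \<beta> k)"
    unfolding diag_def by (metis norm_diff_ineq)
  moreover have "cmod (\<i> * of_nat k * of_real \<beta>) = k * \<bar>\<beta>\<bar>" by (simp add: norm_mult)
  moreover have "k * \<beta> \<le> k * \<bar>\<beta>\<bar>" by (simp add: mult_left_mono)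
  ultimately show ?thesis by (simp add: norm_exp_eq_Re)
qed

text \<open>For k = 2 the triangle inequality of \<open>norm_diag_ge\<close> would give only about
  1. Since sin (2 \<omega>) is small near \<pi>/2, the imaginary part alone gives about 2.\<close>

lemma norm_diag_2_ge: "2 * \<beta> - 2 * \<bar>\<omega> - pi / 2\<bar> \<le> cmod (diag \<omega> \<beta> 2)"
proof -
  have "\<bar>sin (2 * \<omega>)\<bar> \<le> 2 * \<bar>cos \<omega>\<bar>"
    using abs_sin_le_one[of \<omega>] mult_left_le_one_le[of "\<bar>cos \<omega>\<bar>" "\<bar>sin \<omega>\<bar>"]
    by (simp add: sin_double abs_mult)
  moreover have "Im (diag \<omega> \<beta> 2) = 2 * \<beta> - sin (2 * \<omega>)"
    by (simp add: diag_def Im_exp)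
  ultimately show ?thesis
    using abs_le_D1[OF abs_Im_le_cmod[of "diag \<omega> \<beta> 2"]] abs_cos_near_half_pi[of \<omega>] by argo
qed

text \<open>The coordinates are (\<omega>, \<beta>, c), not (\<alpha>, \<omega>, c). The radii do
  not depend on \<epsilon>: 35/1000 leaves room above the bound 9/320 for \<epsilon> |g_1|, and 1/2
  exceeds both \<rho> and the value 4/25 * 49/16 = 0.49 that one application of the map
  produces.\<close>

definition search_box :: "(real \<times> real \<times> (nat \<Rightarrow> complex)) set" where
  "search_box = {(\<omega>, \<beta>, c). \<bar>\<omega> - pi / 2\<bar> \<le> 35/1000 \<and> \<bar>\<beta> - 1\<bar> \<le> 35/1000 \<and> c \<in> ellK_0
     \<and> ell1_norm (opK_inv c) \<le> 1/2}"

lemma boxD: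
  assumes "(\<omega>, \<beta>, c) \<in> search_box"
  shows "\<bar>\<omega> - pi / 2\<bar> \<le> 35/1000" "\<bar>\<beta> - 1\<bar> \<le> 35/1000" "c \<in> ell1" "c 0 = 0" "c (Suc 0) = 0"
    "opK_inv c \<in> ell1" "ell1_norm (opK_inv c) \<le> 1/2" "ell1_norm c \<le> 1/4"
proof -
  show *: "\<bar>\<omega> - pi / 2\<bar> \<le> 35/1000" "\<bar>\<beta> - 1\<bar> \<le> 35/1000" "c \<in> ell1" "c 0 = 0" "c (Suc 0) = 0"
    "opK_inv c \<in> ell1" "ell1_norm (opK_inv c) \<le> 1/2"
    using assms by (auto simp: search_box_def ellK_0_def ell1_0_def ell1_zero_index)
  from ell1_norm_le_opK_inv[of c] * show "ell1_norm c \<le> 1/4" by simp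
qed

text \<open>In the weighted norm, dividing by the diagonal costs the factor k / |diag|. The constant
  8/5 is dictated by k = 3, where |diag| is at least 3 * 0.965 - 1 = 1.895.\<close>

lemma norm_diag_ge_in_box:
  assumes "(\<omega>, \<beta>, c) \<in> search_box" "2 \<le> k"
  shows "k \<le> 8/5 * cmod (diag \<omega> \<beta> k)" "0 < cmod (diag \<omega> \<beta> k)"
proof -
  note b = boxD(1,2)[OF assms(1)]
  show *: "k \<le> 8/5 * cmod (diag \<omega> \<beta> k)"
  proof (cases "k = 2")
    case True
    have "5/4 \<le> cmod (diag \<omega> \<beta> 2)" using norm_diag_2_ge[of \<beta> \<omega>] b(1,2) by argo
    with True show ?thesis by simp
  next
    case False
    with assms(2) have k: "3 \<le> real k" by simp
    have "965/1000 \<le> \<beta>" using b(2) by argo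
    then have "k * (965/1000) \<le> k * \<beta>" by (intro mult_left_mono) simp_all
    with norm_diag_ge[of k \<beta> \<omega>] k show ?thesis by linarith
  qed
  with assms(2) show "0 < cmod (diag \<omega> \<beta> k)" by auto
qed

text \<open>Component 1 supplies the two scalar entries. Its real part cos \<omega> = - \<epsilon>
  Re g_1 becomes a fixed point equation by adding \<omega>; its imaginary part is solved for
  \<beta>. The zeros below index 2 keep the third entry in \<open>ellK_0\<close>.\<close>

definition picard_step :: "real \<Rightarrow> real \<times> real \<times> (nat \<Rightarrow> complex) \<Rightarrow> real \<times> real \<times> (nat \<Rightarrow> complex)" where
  "picard_step \<epsilon> = (\<lambda>(\<omega>, \<beta>, c). (\<omega> + cos \<omega> + \<epsilon> * Re (nlin \<omega> c 1), sin \<omega> - \<epsilon> * Im (nlin \<omega> c 1),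
     \<lambda>k. if k < 2 then 0 else - of_real \<epsilon> * nlin \<omega> c k / diag \<omega> \<beta> k))"

lemma opL_expand:
  "1 \<le> k \<Longrightarrow> opL \<omega> c k = (if k = 1 then 0 else
      (exp (- \<i> * of_real \<omega>) + exp (- \<i> * of_nat (k - 1) * of_real \<omega>)) * c (k - 1))
    + (exp (\<i> * of_real \<omega>) + exp (- \<i> * of_nat (k + 1) * of_real \<omega>)) * c (k + 1)"
  by (simp add: opL_def shift_plus_def shift_minus_def opU_def algebra_simps)

lemma nlin_1:
  "nlin \<omega> c 1 = (exp (\<i> * of_real \<omega>) + exp (- \<i> * 2 * of_real \<omega>)) * c 2 + conv (opU \<omega> c) c 1"
  using opL_expand[of 1 \<omega> c] by (simp add: nlin_def unit_seq_def numeral_2_eq_2)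

lemma norm_exp_sum_le_2: "cmod (exp (\<i> * of_real x) + exp (- \<i> * of_nat k * of_real y)) \<le> 2"
  by (rule order_trans[OF norm_triangle_ineq]) (simp add: norm_exp_eq_Re)

lemma norm_nlin_1_in_box:
  assumes "(\<omega>, \<beta>, c) \<in> search_box"
  shows "cmod (nlin \<omega> c 1) \<le> 9/32"
proof -
  note b = boxD[OF assms]
  have "2 * cmod (opK_inv c 2) \<le> 1/2" using norm_le_ell1_norm[OF b(6), of 2] b(7) by simp
  then have c2: "cmod (c 2) \<le> 1/8" by (simp add: opK_inv_def norm_mult)
  note q = ell1_conv[OF ell1_opU(1)[OF b(3)] b(3), of \<omega>]
  have "ell1_norm (conv (opU \<omega> c) c) \<le> (1/4) * (1/4)"
    using q(2) mult_mono[OF b(8) b(8)] by (simp add: ell1_opU(2)[OF b(3)] ell1_norm_nonneg)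
  then have c: "cmod (conv (opU \<omega> c) c 1) \<le> 1/32"
    using norm_le_ell1_norm[OF q(1), of 1] by simp
  have "cmod ((exp (\<i> * of_real \<omega>) + exp (- \<i> * 2 * of_real \<omega>)) * c 2) \<le> 2 * (1/8)"
    unfolding norm_mult using norm_exp_sum_le_2[of \<omega> 2 \<omega>] by (intro mult_mono c2) auto
  with c show ?thesis unfolding nlin_1 by (intro order_trans[OF norm_triangle_ineq]) simp
qed

lemma step_in_box:
  assumes x: "x \<in> search_box" and e: "0 \<le> \<epsilon>" "\<epsilon> \<le> 1/10"
  shows "picard_step \<epsilon> x \<in> search_box"
proof -
  obtain \<omega> \<beta> c where [simp]: "x = (\<omega>, \<beta>, c)" by (cases x)
  have x': "(\<omega>, \<beta>, c) \<in> search_box" using x by simp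
  note b = boxD[OF x']
  have z: "\<bar>\<epsilon> * Re (nlin \<omega> c 1)\<bar> \<le> 9/320" "\<bar>\<epsilon> * Im (nlin \<omega> c 1)\<bar> \<le> 9/320"
    using norm_nlin_1_in_box[OF x'] abs_Re_le_cmod[of "nlin \<omega> c 1"] abs_Im_le_cmod[of "nlin \<omega> c 1"]
      mult_mono[OF e(2), of "\<bar>Re (nlin \<omega> c 1)\<bar>" "9/32"] mult_mono[OF e(2), of "\<bar>Im (nlin \<omega> c 1)\<bar>" "9/32"]
    using e(1) by (simp_all add: abs_mult)
  have "\<bar>(\<omega> + cos \<omega>) - (pi / 2 + cos (pi / 2))\<bar> \<le> (35/1000)\<^sup>2 / 2 * \<bar>\<omega> - pi / 2\<bar>"
    by (rule add_cos_lipschitz) (use b in auto)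
  with z(1) b(1) have 1: "\<bar>(\<omega> + cos \<omega> + \<epsilon> * Re (nlin \<omega> c 1)) - pi / 2\<bar> \<le> 35/1000"
    unfolding power2_eq_square cos_pi_half by argo
  have 2: "\<bar>(sin \<omega> - \<epsilon> * Im (nlin \<omega> c 1)) - 1\<bar> \<le> 35/1000"
    using z(2) sin_near_half_pi[OF b(1)] sin_le_one[of \<omega>] unfolding power2_eq_square by argo
  define c' where "c' = (\<lambda>k. if k < 2 then 0 else - of_real \<epsilon> * nlin \<omega> c k / diag \<omega> \<beta> k)"
  note g = ell1_nlin[OF b(3), of \<omega>]
  have c'01: "c' 0 = 0" "c' 1 = 0" by (simp_all add: c'_def)
  \<comment> \<open>4/25 = 1/10 * 8/5: the bound for \<epsilon> times the one for k /
    |diag|.\<close>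
  have le: "cmod (opK_inv c' k) \<le> (4/25) * cmod (nlin \<omega> c k)" if "1 \<le> k" for k
  proof (cases "k < 2")
    case False
    then have k: "2 \<le> k" by simp
    note d = norm_diag_ge_in_box[OF x' k]
    have "cmod (opK_inv c' k) = \<epsilon> * (k / cmod (diag \<omega> \<beta> k)) * cmod (nlin \<omega> c k)"
      using False e by (simp add: opK_inv_def c'_def norm_mult norm_divide)
    also have "\<dots> \<le> (1/10) * (8/5) * cmod (nlin \<omega> c k)"
      using d e by (intro mult_right_mono mult_mono) (auto simp: divide_simps mult_ac)
    finally show ?thesis by simp
  qed (simp add: opK_inv_def c'_def)
  have "opK_inv c' 0 = 0" by (simp add: opK_inv_def)
  from ell1_dominated[OF g(1) this le]
  have K: "opK_inv c' \<in> ell1" "ell1_norm (opK_inv c') \<le> 4/25 * ell1_norm (nlin \<omega> c)" by auto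
  have "(ell1_norm c)\<^sup>2 \<le> (1/4)\<^sup>2" by (rule power_mono[OF b(8) ell1_norm_nonneg])
  with K(2) g(2) b(8) have "ell1_norm (opK_inv c') \<le> 1/2" by (simp add: power2_eq_square)
  with 1 2 K(1) c'01 ell1_of_opK_inv[OF K(1) c'01(1)]
  show ?thesis by (simp add: picard_step_def search_box_def ellK_0_def ell1_0_def c'_def)
qed

text \<open>The weight 2/5 balances the Lipschitz constants of the scalar components and of the sequence.\<close>
definition box_dist ::
    "real \<times> real \<times> (nat \<Rightarrow> complex) \<Rightarrow> real \<times> real \<times> (nat \<Rightarrow> complex) \<Rightarrow> real" where
  "box_dist = (\<lambda>(\<omega>, \<beta>, c) (\<omega>', \<beta>', c').
     \<bar>\<omega> - \<omega>'\<bar> + \<bar>\<beta> - \<beta>'\<bar> + 2/5 * ell1_norm (\<lambda>k. opK_inv c k - opK_inv c' k))"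

lemma step_contraction:
  assumes x: "x \<in> search_box" and y: "y \<in> search_box" and e: "0 \<le> \<epsilon>" "\<epsilon> \<le> 1/10"
  shows "box_dist (picard_step \<epsilon> x) (picard_step \<epsilon> y) \<le> 95/100 * box_dist x y"
proof -
  obtain \<omega> \<beta> c where [simp]: "x = (\<omega>, \<beta>, c)" by (cases x)
  obtain \<omega>' \<beta>' c' where [simp]: "y = (\<omega>', \<beta>', c')" by (cases y)
  have x': "(\<omega>, \<beta>, c) \<in> search_box" and y': "(\<omega>', \<beta>', c') \<in> search_box" using x y by simp_all
  note b = boxD[OF x'] and b' = boxD[OF y']
  define g where "g = nlin \<omega> c"
  define g' where "g' = nlin \<omega>' c'"
  define n where "n = ell1_norm (\<lambda>k. opK_inv c k - opK_inv c' k)"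
  define h where "h = \<bar>\<beta> - \<beta>'\<bar> + \<bar>\<omega> - \<omega>'\<bar>"
  define D where "D = ell1_norm (\<lambda>k. g k - g' k)"
  have n0: "0 \<le> n" by (simp add: n_def ell1_norm_nonneg)
  have h0: "0 \<le> h" by (simp add: h_def)
  have "opK_inv (\<lambda>k. c k - c' k) \<in> ell1"
    unfolding opK_inv_diff by (rule ell1_diff(1)[OF b(6) b'(6)])
  from ell1_norm_le_opK_inv[OF this] b b'
  have cn: "ell1_norm (\<lambda>k. c k - c' k) \<le> n / 2"
    unfolding opK_inv_diff n_def by simp
  note G = ell1_nlin_lipschitz[OF b(3) b'(3) b(6), of \<omega> \<omega>', folded g_def g'_def D_def]
  note g'm = ell1_nlin[OF b'(3), of \<omega>', folded g'_def]
  have g'n: "ell1_norm g' \<le> 49/16"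
    using g'm(2) b'(8) power_mono[OF b'(8) ell1_norm_nonneg, of 2] by (simp add: power2_eq_square)
  have "ell1_norm (opK_inv c) * ell1_norm c \<le> 1/2 * (1/4)"
    using b by (intro mult_mono) (auto simp: ell1_norm_nonneg)
  then have "2 + 2 * ell1_norm c + 2 * ell1_norm (opK_inv c) + ell1_norm (opK_inv c) * ell1_norm c \<le> 29/8"
    using b by simp
  from mult_left_mono[OF this abs_ge_zero[of "\<omega> - \<omega>'"]]
  have "\<bar>\<omega> - \<omega>'\<bar> * (2 + 2 * ell1_norm c + 2 * ell1_norm (opK_inv c) + ell1_norm (opK_inv c) * ell1_norm c)
      \<le> \<bar>\<omega> - \<omega>'\<bar> * (29/8)" .
  moreover have "(4 + ell1_norm c + ell1_norm c') * ell1_norm (\<lambda>k. c k - c' k) \<le> 9/2 * (n / 2)"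
    using b b' cn by (intro mult_mono) (auto simp: ell1_norm_nonneg n0)
  ultimately have D: "D \<le> 29/8 * \<bar>\<omega> - \<omega>'\<bar> + 9/4 * n" using G(2) unfolding D_def by linarith
  have g1: "cmod (g 1 - g' 1) \<le> D / 2"
    using norm_le_ell1_norm[OF G(1), of 1] by (simp add: D_def)
  have D0: "0 \<le> D" by (simp add: D_def ell1_norm_nonneg)
  have reim: "\<bar>Re (g 1) - Re (g' 1)\<bar> \<le> D / 2" "\<bar>Im (g 1) - Im (g' 1)\<bar> \<le> D / 2"
    using abs_Re_le_cmod[of "g 1 - g' 1"] abs_Im_le_cmod[of "g 1 - g' 1"] g1 by simp_all
  have eg: "\<epsilon> * \<bar>Re (g 1) - Re (g' 1)\<bar> \<le> 1/10 * (D / 2)" "\<epsilon> * \<bar>Im (g 1) - Im (g' 1)\<bar> \<le> 1/10 * (D / 2)"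
    by (intro mult_mono e reim; simp)+
  have row1: "\<bar>(\<omega> + cos \<omega> + \<epsilon> * Re (g 1)) - (\<omega>' + cos \<omega>' + \<epsilon> * Re (g' 1))\<bar>
      \<le> 1/1000 * \<bar>\<omega> - \<omega>'\<bar> + D / 20"
  proof -
    have "\<bar>(\<omega> + cos \<omega>) - (\<omega>' + cos \<omega>')\<bar> \<le> (35/1000)\<^sup>2 / 2 * \<bar>\<omega> - \<omega>'\<bar>"
      by (rule add_cos_lipschitz) (use b b' in auto)
    also have "\<dots> \<le> 1/1000 * \<bar>\<omega> - \<omega>'\<bar>" by (simp add: power2_eq_square)
    finally have "\<bar>(\<omega> + cos \<omega>) - (\<omega>' + cos \<omega>')\<bar> \<le> 1/1000 * \<bar>\<omega> - \<omega>'\<bar>" .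
    moreover have "\<bar>\<epsilon> * (Re (g 1) - Re (g' 1))\<bar> \<le> D / 20"
      using eg e by (simp add: abs_mult)
    ultimately show ?thesis unfolding right_diff_distrib by argo
  qed
  have row2: "\<bar>(sin \<omega> - \<epsilon> * Im (g 1)) - (sin \<omega>' - \<epsilon> * Im (g' 1))\<bar>
      \<le> 35/1000 * \<bar>\<omega> - \<omega>'\<bar> + D / 20"
  proof -
    have "\<bar>sin \<omega> - sin \<omega>'\<bar> \<le> 35/1000 * \<bar>\<omega> - \<omega>'\<bar>"
      by (rule sin_lipschitz_near_half_pi) (use b b' in auto)
    moreover have "\<bar>\<epsilon> * (Im (g 1) - Im (g' 1))\<bar> \<le> D / 20"
      using eg e by (simp add: abs_mult)
    ultimately show ?thesis unfolding right_diff_distrib by argo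
  qed
  \<comment> \<open>The quotient g / diag changes through its numerator (\<open>p\<close>) and
    through its denominator (\<open>q\<close>). In \<open>q\<close> two factors k occur, the weight
    and the growth of the difference of the diagonals; each is absorbed by one of the two
    denominators.\<close>
  define p where "p = (\<lambda>k. if k < 2 then 0 else - of_real \<epsilon> * (of_nat k / diag \<omega> \<beta> k) * (g k - g' k))"
  define q where "q = (\<lambda>k. if k < 2 then 0 else
     of_real \<epsilon> * (of_nat k / diag \<omega> \<beta> k) * ((diag \<omega> \<beta> k - diag \<omega>' \<beta>' k) / diag \<omega>' \<beta>' k) * g' k)"
  have p: "cmod (p k) \<le> 4/25 * cmod (g k - g' k)" if "1 \<le> k" for k
  proof (cases "k < 2")
    case False
    then have k: "2 \<le> k" by simp
    note d = norm_diag_ge_in_box[OF x' k]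
    have "cmod (p k) = \<epsilon> * (k / cmod (diag \<omega> \<beta> k)) * cmod (g k - g' k)"
      using False e by (simp add: p_def norm_mult norm_divide)
    also have "\<dots> \<le> (1/10) * (8/5) * cmod (g k - g' k)"
      using d e by (intro mult_right_mono mult_mono) (auto simp: divide_simps mult_ac)
    finally show ?thesis by simp
  qed (simp add: p_def)
  have q: "cmod (q k) \<le> (32/125 * h) * cmod (g' k)" if "1 \<le> k" for k
  proof (cases "k < 2")
    case False
    then have k: "2 \<le> k" by simp
    note d = norm_diag_ge_in_box[OF x' k] and d' = norm_diag_ge_in_box[OF y' k]
    have "cmod (diag \<omega> \<beta> k - diag \<omega>' \<beta>' k) / cmod (diag \<omega>' \<beta>' k) \<le> k * h / cmod (diag \<omega>' \<beta>' k)"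
      unfolding h_def using norm_diag_diff by (rule divide_right_mono) simp
    also have "\<dots> = (k / cmod (diag \<omega>' \<beta>' k)) * h" by simp
    also have "\<dots> \<le> 8/5 * h"
      using d' h0 by (intro mult_right_mono) (auto simp: divide_simps mult_ac)
    finally have dd: "cmod (diag \<omega> \<beta> k - diag \<omega>' \<beta>' k) / cmod (diag \<omega>' \<beta>' k) \<le> 8/5 * h" .
    have "cmod (q k) = \<epsilon> * (k / cmod (diag \<omega> \<beta> k))
        * (cmod (diag \<omega> \<beta> k - diag \<omega>' \<beta>' k) / cmod (diag \<omega>' \<beta>' k)) * cmod (g' k)"
      using False e by (simp add: q_def norm_mult norm_divide)
    also have "\<dots> \<le> (1/10) * (8/5) * (8/5 * h) * cmod (g' k)"
      using d e h0 by (intro mult_right_mono mult_mono dd) (auto simp: divide_simps mult_ac)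
    finally show ?thesis by simp
  qed (simp add: q_def h0)
  have z: "p 0 = 0" "q 0 = 0" by (simp_all add: p_def q_def)
  note P = ell1_dominated[OF G(1) z(1) p] and Q = ell1_dominated[OF g'm(1) z(2) q]
  have pq: "opK_inv (\<lambda>k. if k < 2 then 0 else - of_real \<epsilon> * g k / diag \<omega> \<beta> k) k
      - opK_inv (\<lambda>k. if k < 2 then 0 else - of_real \<epsilon> * g' k / diag \<omega>' \<beta>' k) k = p k + q k" for k
  proof (cases "k < 2")
    case False
    then have k: "2 \<le> k" by simp
    have nz: "diag \<omega> \<beta> k \<noteq> 0" "diag \<omega>' \<beta>' k \<noteq> 0"
      using norm_diag_ge_in_box(2)[OF x' k] norm_diag_ge_in_box(2)[OF y' k] by auto
    with False show ?thesis by (simp add: opK_inv_def p_def q_def field_simps)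
  qed (simp add: opK_inv_def p_def q_def)
  have row3: "ell1_norm (\<lambda>k. opK_inv (\<lambda>k. if k < 2 then 0 else - of_real \<epsilon> * g k / diag \<omega> \<beta> k) k
      - opK_inv (\<lambda>k. if k < 2 then 0 else - of_real \<epsilon> * g' k / diag \<omega>' \<beta>' k) k)
      \<le> 4/25 * D + 98/125 * h"
  proof -
    have "ell1_norm (\<lambda>k. p k + q k) \<le> 4/25 * D + (32/125 * h) * ell1_norm g'"
      using ell1_add(2)[OF P(1) Q(1)] P(2) Q(2) by (simp add: D_def)
    also have "(32/125 * h) * ell1_norm g' \<le> (32/125 * h) * (49/16)"
      using g'n h0 by (intro mult_left_mono) auto
    finally show ?thesis by (simp add: pq)
  qed
  have "box_dist (picard_step \<epsilon> x) (picard_step \<epsilon> y) =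
      \<bar>(\<omega> + cos \<omega> + \<epsilon> * Re (g 1)) - (\<omega>' + cos \<omega>' + \<epsilon> * Re (g' 1))\<bar>
      + \<bar>(sin \<omega> - \<epsilon> * Im (g 1)) - (sin \<omega>' - \<epsilon> * Im (g' 1))\<bar>
      + 2/5 * ell1_norm (\<lambda>k. opK_inv (\<lambda>k. if k < 2 then 0 else - of_real \<epsilon> * g k / diag \<omega> \<beta> k) k
        - opK_inv (\<lambda>k. if k < 2 then 0 else - of_real \<epsilon> * g' k / diag \<omega>' \<beta>' k) k)"
    unfolding box_dist_def picard_step_def g_def g'_def by simp
  also have "\<dots>
      \<le> (1/1000 * \<bar>\<omega> - \<omega>'\<bar> + D / 20) + (35/1000 * \<bar>\<omega> - \<omega>'\<bar> + D / 20) + 2/5 * (4/25 * D + 98/125 * h)"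
    by (intro add_mono mult_left_mono row1 row2 row3) simp
  \<comment> \<open>After collecting terms, the coefficients of the change of \<omega>, the change
    of \<beta> and \<open>n\<close> are about 0.944, 0.314 and 0.369, against 0.95, 0.95 and 0.95 *
    2/5 = 0.38.\<close>
  also have "\<dots> \<le> 95/100 * (\<bar>\<omega> - \<omega>'\<bar> + \<bar>\<beta> - \<beta>'\<bar> + 2/5 * n)"
    using D n0 abs_ge_zero[of "\<omega> - \<omega>'"] abs_ge_zero[of "\<beta> - \<beta>'"] unfolding h_def by argo
  finally show ?thesis by (simp add: box_dist_def n_def)
qed

section \<open>Existence and uniqueness of the fixed point\<close>

interpretation Box: Metric_space search_box box_dist
proof
  fix x y :: "real \<times> real \<times> (nat \<Rightarrow> complex)"
  show "0 \<le> box_dist x y"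
    by (cases x; cases y) (simp add: box_dist_def ell1_norm_nonneg)
  show "box_dist x y = box_dist y x"
    by (cases x; cases y)
      (auto simp: box_dist_def abs_minus_commute intro: ell1_norm_minus_commute)
next
  fix x y assume xy: "x \<in> search_box" "y \<in> search_box"
  obtain \<omega> \<beta> c where [simp]: "x = (\<omega>, \<beta>, c)" by (cases x)
  obtain \<omega>' \<beta>' c' where [simp]: "y = (\<omega>', \<beta>', c')" by (cases y)
  have b: "(\<omega>, \<beta>, c) \<in> search_box" "(\<omega>', \<beta>', c') \<in> search_box" using xy by simp_all
  note m = ell1_diff(1)[OF boxD(6)[OF b(1)] boxD(6)[OF b(2)]]
  \<comment> \<open>Membership in the box matters: an infinite sum without convergence has the value
    0, so a vanishing norm is informative only for differences in \<open>ell1\<close>.\<close>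
  show "box_dist x y = 0 \<longleftrightarrow> x = y"
  proof
    assume "box_dist x y = 0"
    moreover have "0 \<le> ell1_norm (\<lambda>k. opK_inv c k - opK_inv c' k)" by (rule ell1_norm_nonneg)
    ultimately have z: "\<omega> = \<omega>'" "\<beta> = \<beta>'" "ell1_norm (\<lambda>k. opK_inv c k - opK_inv c' k) = 0"
      by (simp_all add: box_dist_def)
    have "opK_inv c k - opK_inv c' k = 0" for k
      using fun_cong[OF ell1_norm_eq_0[OF m z(3)], of k] .
    then have "opK_inv c = opK_inv c'" by (simp add: fun_eq_iff)
    then have "c = c'"
      using opK_opK_inv[of c, OF boxD(4)[OF b(1)]] opK_opK_inv[of c', OF boxD(4)[OF b(2)]] by metis
    with z show "x = y" by simp
  qed (simp add: box_dist_def ell1_norm_def)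
next
  fix x y z assume xyz: "x \<in> search_box" "y \<in> search_box" "z \<in> search_box"
  obtain \<omega> \<beta> c where [simp]: "x = (\<omega>, \<beta>, c)" by (cases x)
  obtain \<omega>' \<beta>' c' where [simp]: "y = (\<omega>', \<beta>', c')" by (cases y)
  obtain \<omega>'' \<beta>'' c'' where [simp]: "z = (\<omega>'', \<beta>'', c'')" by (cases z)
  have b: "opK_inv c \<in> ell1" "opK_inv c' \<in> ell1" "opK_inv c'' \<in> ell1"
    using xyz boxD(6) by auto
  have "ell1_norm (\<lambda>k. opK_inv c k - opK_inv c'' k)
      \<le> ell1_norm (\<lambda>k. opK_inv c k - opK_inv c' k) + ell1_norm (\<lambda>k. opK_inv c' k - opK_inv c'' k)"
    using ell1_add(2)[OF ell1_diff(1)[OF b(1,2)] ell1_diff(1)[OF b(2,3)]] by simp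
  moreover have "\<bar>\<omega> - \<omega>''\<bar> \<le> \<bar>\<omega> - \<omega>'\<bar> + \<bar>\<omega>' - \<omega>''\<bar>" "\<bar>\<beta> - \<beta>''\<bar> \<le> \<bar>\<beta> - \<beta>'\<bar> + \<bar>\<beta>' - \<beta>''\<bar>"
    by simp_all
  ultimately show "box_dist x z \<le> box_dist x y + box_dist y z"
    by (simp add: box_dist_def)
qed

text \<open>Lower semicontinuity of the norm under componentwise convergence, because finite partial
  sums pass to the limit. The premises are asked from \<open>n0\<close> on only, as the completeness
  proof has its bound only for late indices.\<close>

lemma ell1_fatou:
  assumes m: "\<And>n. n \<ge> n0 \<Longrightarrow> a n \<in> ell1" and B: "\<And>n. n \<ge> n0 \<Longrightarrow> ell1_norm (a n) \<le> B"
    and lim: "\<And>k. (\<lambda>n. a n k) \<longlonglongrightarrow> l k"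
  shows "l \<in> ell1" "ell1_norm l \<le> B"
proof -
  have l0: "l 0 = 0"
  proof (rule LIMSEQ_unique[OF lim[of 0]])
    show "(\<lambda>n. a n 0) \<longlonglongrightarrow> 0"
      by (rule tendsto_eventually)
        (use m ell1_zero_index in \<open>auto simp: eventually_sequentially intro!: exI[of _ n0]\<close>)
  qed
  have fin: "(\<Sum>k\<in>F. cmod (l k)) \<le> B / 2" if F: "finite F" "F \<subseteq> {1..}" for F
  proof (rule LIMSEQ_le_const2)
    show "(\<lambda>n. \<Sum>k\<in>F. cmod (a n k)) \<longlonglongrightarrow> (\<Sum>k\<in>F. cmod (l k))"
      by (intro tendsto_sum tendsto_norm lim)
    show "\<exists>N. \<forall>n\<ge>N. (\<Sum>k\<in>F. cmod (a n k)) \<le> B / 2"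
      using sum_le_ell1_norm[OF m F] B by (intro exI[of _ n0]) fastforce
  qed
  have s: "(\<lambda>k. cmod (l k)) summable_on {1..}"
    by (rule nonneg_bdd_above_summable_on) (use fin in \<open>auto intro!: bdd_aboveI[of _ "B / 2"]\<close>)
  with l0 show "l \<in> ell1" by (simp add: ell1_def)
  show "ell1_norm l \<le> B"
    using infsum_le_finite_sums[OF s fin] by (simp add: ell1_norm_def)
qed

lemma Box_mcomplete: "Box.mcomplete"
  unfolding Box.mcomplete_def
proof (intro allI impI)
  fix \<sigma> assume cau: "Box.MCauchy \<sigma>"
  define w where "w n = fst (\<sigma> n)" for n
  define b where "b n = fst (snd (\<sigma> n))" for n
  define c where "c n = snd (snd (\<sigma> n))" for n
  have \<sigma>: "\<sigma> n = (w n, b n, c n)" for n by (simp add: w_def b_def c_def)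
  have inbox: "(w n, b n, c n) \<in> search_box" for n
    using cau by (auto simp: Box.MCauchy_def simp flip: \<sigma>)
  note bx = boxD[OF inbox]
  have ex: "\<exists>N. \<forall>n\<ge>N. \<forall>m\<ge>N. box_dist (\<sigma> n) (\<sigma> m) < e" if "0 < e" for e
    using cau that unfolding Box.MCauchy_def by meson
  have dm: "(\<lambda>k. opK_inv (c n) k - opK_inv (c m) k) \<in> ell1" for n m
    by (rule ell1_diff(1)[OF bx(6) bx(6)])
  have dist: "box_dist (\<sigma> n) (\<sigma> m) = \<bar>w n - w m\<bar> + \<bar>b n - b m\<bar>
      + 2/5 * ell1_norm (\<lambda>k. opK_inv (c n) k - opK_inv (c m) k)" for n m
    by (simp add: \<sigma> box_dist_def)
  have dk: "4/5 * cmod (opK_inv (c n) k - opK_inv (c m) k) \<le> box_dist (\<sigma> n) (\<sigma> m)" for n m k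
    using norm_le_ell1_norm[OF dm[of n m], of k] unfolding dist by argo
  have "Cauchy w"
  proof (rule metric_CauchyI)
    fix e :: real assume "0 < e"
    from ex[OF this] obtain N where N: "\<forall>n\<ge>N. \<forall>m\<ge>N. box_dist (\<sigma> n) (\<sigma> m) < e" ..
    have "\<bar>w n - w m\<bar> \<le> box_dist (\<sigma> n) (\<sigma> m)" for n m
      unfolding dist using ell1_norm_nonneg by (simp add: add_nonneg_nonneg add.assoc)
    with N show "\<exists>M. \<forall>m\<ge>M. \<forall>n\<ge>M. dist (w m) (w n) < e"
      unfolding dist_real_def by (meson le_less_trans)
  qed
  then obtain w' where w': "w \<longlonglongrightarrow> w'" using Cauchy_convergent convergent_def by blast
  have "Cauchy b"
  proof (rule metric_CauchyI)
    fix e :: real assume "0 < e"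
    from ex[OF this] obtain N where N: "\<forall>n\<ge>N. \<forall>m\<ge>N. box_dist (\<sigma> n) (\<sigma> m) < e" ..
    have "\<bar>b n - b m\<bar> \<le> box_dist (\<sigma> n) (\<sigma> m)" for n m
      unfolding dist using ell1_norm_nonneg by (simp add: add_nonneg_nonneg add.assoc)
    with N show "\<exists>M. \<forall>m\<ge>M. \<forall>n\<ge>M. dist (b m) (b n) < e"
      unfolding dist_real_def by (meson le_less_trans)
  qed
  then obtain b' where b': "b \<longlonglongrightarrow> b'" using Cauchy_convergent convergent_def by blast
  have "\<exists>l. (\<lambda>n. opK_inv (c n) k) \<longlonglongrightarrow> l" for k
  proof -
    have "Cauchy (\<lambda>n. opK_inv (c n) k)"
    proof (rule metric_CauchyI)
      fix e :: real assume "0 < e"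
      then have "0 < 4/5 * e" by simp
      from ex[OF this] obtain N where N: "\<forall>n\<ge>N. \<forall>m\<ge>N. box_dist (\<sigma> n) (\<sigma> m) < 4/5 * e" ..
      have "dist (opK_inv (c m) k) (opK_inv (c n) k) < e" if "m \<ge> N" "n \<ge> N" for m n
        using le_less_trans[OF dk[of m k n] N[rule_format, OF that]] by (simp add: dist_norm)
      then show "\<exists>M. \<forall>m\<ge>M. \<forall>n\<ge>M. dist (opK_inv (c m) k) (opK_inv (c n) k) < e" by blast
    qed
    then show ?thesis using Cauchy_convergent convergent_def by blast
  qed
  then obtain l where l: "\<And>k. (\<lambda>n. opK_inv (c n) k) \<longlonglongrightarrow> l k" by metis
  note lm = ell1_fatou[of 0, OF bx(6) bx(7) l]
  \<comment> \<open>The limit is taken for the weighted sequences, which the metric sees; since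
    \<open>l 0 = 0\<close>, removing the weight can be undone.\<close>
  define c' where "c' = opK l"
  have Kc': "opK_inv c' = l"
    unfolding c'_def by (rule opK_inv_opK[of l, OF ell1_zero_index[OF lm(1)]])
  have l1: "l 1 = 0"
    by (rule LIMSEQ_unique[OF l[of 1]]) (simp add: opK_inv_def bx(5))
  have c'01: "c' 0 = 0" "c' 1 = 0" by (simp_all add: c'_def opK_def l1[simplified])
  have c'm: "c' \<in> ell1"
    by (rule ell1_of_opK_inv) (use Kc' lm c'01 in auto)
  have "\<bar>w' - pi / 2\<bar> \<le> 35/1000"
    by (rule LIMSEQ_le_const2[of "\<lambda>n. \<bar>w n - pi / 2\<bar>"]) (intro tendsto_intros w', use bx(1) in blast)
  moreover have "\<bar>b' - 1\<bar> \<le> 35/1000"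
    by (rule LIMSEQ_le_const2[of "\<lambda>n. \<bar>b n - 1\<bar>"]) (intro tendsto_intros b', use bx(2) in blast)
  ultimately have mem: "(w', b', c') \<in> search_box"
    using lm c'm c'01 by (simp add: search_box_def ellK_0_def ell1_0_def Kc')
  have "limitin Box.mtopology \<sigma> (w', b', c') sequentially"
  proof (rule Box.limit_metric_sequentially[THEN iffD2], intro conjI allI impI)
    show "(w', b', c') \<in> search_box" by (rule mem)
    fix e :: real assume e: "0 < e"
    then have "0 < e / 2" by simp
    from ex[OF this] obtain N where N: "\<forall>n\<ge>N. \<forall>m\<ge>N. box_dist (\<sigma> n) (\<sigma> m) < e / 2" ..
    have "box_dist (\<sigma> n) (w', b', c') < e" if n: "n \<ge> N" for n
    proof -
      define r where "r m = \<bar>w n - w m\<bar> + \<bar>b n - b m\<bar>" for m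
      have r: "r \<longlonglongrightarrow> \<bar>w n - w'\<bar> + \<bar>b n - b'\<bar>"
        unfolding r_def by (intro tendsto_intros w' b')
      have rd: "5/2 * (box_dist (\<sigma> n) (\<sigma> m) - r m) = ell1_norm (\<lambda>k. opK_inv (c n) k - opK_inv (c m) k)" for m
        by (simp add: dist r_def)
      have "\<exists>M. \<forall>m\<ge>M. \<bar>w n - w'\<bar> + \<bar>b n - b'\<bar> - e / 4 < r m"
        using order_tendstoD(1)[OF r, of "\<bar>w n - w'\<bar> + \<bar>b n - b'\<bar> - e / 4"] e
        by (auto simp: eventually_sequentially)
      then obtain M where M: "\<And>m. m \<ge> M \<Longrightarrow> \<bar>w n - w'\<bar> + \<bar>b n - b'\<bar> - e / 4 < r m" by blast
      \<comment> \<open>For late m the scalar part \<open>r m\<close> exceeds its limit minus e / 4,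
        which leaves the sequence part the budget e / 2 - (limit - e / 4), up to the weight 5/2.
        Adding the limit of the scalar part back gives a total of 3/4 e.\<close>
      have "ell1_norm (\<lambda>k. opK_inv (c n) k - l k) \<le> 5/2 * (e / 2 - (\<bar>w n - w'\<bar> + \<bar>b n - b'\<bar> - e / 4))"
      proof (rule ell1_fatou(2))
        fix m assume m: "max M N \<le> m"
        show "(\<lambda>k. opK_inv (c n) k - opK_inv (c m) k) \<in> ell1" by (rule dm)
        have "box_dist (\<sigma> n) (\<sigma> m) < e / 2" using N n m by simp
        with M[of m] m
        show "ell1_norm (\<lambda>k. opK_inv (c n) k - opK_inv (c m) k)
          \<le> 5/2 * (e / 2 - (\<bar>w n - w'\<bar> + \<bar>b n - b'\<bar> - e / 4))"
          unfolding rd[symmetric] by simp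
      qed (intro tendsto_intros l)
      then show ?thesis using e by (simp add: \<sigma> box_dist_def Kc')
    qed
    then show "\<exists>N. \<forall>n\<ge>N. \<sigma> n \<in> search_box \<and> box_dist (\<sigma> n) (w', b', c') < e"
      using inbox by (auto simp: \<sigma>)
  qed
  then show "\<exists>x. limitin Box.mtopology \<sigma> x sequentially" by blast
qed

lemma box_nonempty: "(pi / 2, 1, \<lambda>k. 0) \<in> search_box"
  by (simp add: search_box_def ellK_0_def ell1_0_def ell1_def opK_inv_def ell1_norm_def)

lemma step_fixpoint_exists:
  assumes "0 \<le> \<epsilon>" "\<epsilon> \<le> 1/10"
  shows "\<exists>x\<in>search_box. picard_step \<epsilon> x = x"
proof -
  obtain x where "x \<in> search_box" "picard_step \<epsilon> x = x"
  proof (rule Box.Banach_fixedpoint_thm[OF Box_mcomplete, of "picard_step \<epsilon>" "95/100"])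
    show "search_box \<noteq> {}" using box_nonempty by blast
  qed (use step_in_box[OF _ assms] step_contraction[OF _ _ assms] in auto)
  then show ?thesis by blast
qed

lemma step_fixpoint_unique:
  assumes "0 \<le> \<epsilon>" "\<epsilon> \<le> 1/10" "x \<in> search_box" "y \<in> search_box" "picard_step \<epsilon> x = x" "picard_step \<epsilon> y = y"
  shows "x = y"
proof -
  have "box_dist x y \<le> 95/100 * box_dist x y"
    using step_contraction[OF assms(3,4,1,2)] assms(5,6) by simp
  then have "box_dist x y = 0" using Box.nonneg[of x y] by linarith
  then show ?thesis using assms by simp
qed

section \<open>Zeros of F as fixed points\<close>

lemma F_op_eq:
  assumes "c 0 = 0" "\<omega> = \<alpha> * \<beta>"
  shows "F_op \<epsilon> (\<alpha>, \<omega>, c) k = of_real \<alpha> * ((\<i> * of_real \<beta> + exp (- \<i> * of_real \<omega>)) * unit_seq 1 k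
     + diag \<omega> \<beta> k * c k + of_real \<epsilon> * nlin \<omega> c k)"
proof -
  have "\<i> * of_real \<omega> = of_real \<alpha> * (\<i> * of_real \<beta>)"
    by (simp add: assms(2))
  then show ?thesis
    unfolding F_op_def prod.case
    by (simp add: nlin_def diag_def opK_inv_def opU_def[of _ c] distrib_left distrib_right mult_ac)
qed

text \<open>Index 0 holds by convention. Index 1 contains no diagonal term, as
  \<open>c 1 = 0\<close>, and amounts to the two scalar equations. From index 2 on the diagonal
  factor is nonzero in the box, so dividing by it is an equivalence.\<close>

lemma F_op_eq_0_iff:
  assumes b: "(\<omega>, \<beta>, c) \<in> search_box" and \<alpha>: "\<alpha> \<noteq> 0" "\<omega> = \<alpha> * \<beta>"
  shows "F_op \<epsilon> (\<alpha>, \<omega>, c) = (\<lambda>k. 0) \<longleftrightarrow> picard_step \<epsilon> (\<omega>, \<beta>, c) = (\<omega>, \<beta>, c)"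
proof -
  note c = boxD(4,5)[OF b]
  let ?G = "\<lambda>k. (\<i> * of_real \<beta> + exp (- \<i> * of_real \<omega>)) * unit_seq 1 k
     + diag \<omega> \<beta> k * c k + of_real \<epsilon> * nlin \<omega> c k"
  have F: "F_op \<epsilon> (\<alpha>, \<omega>, c) = (\<lambda>k. 0) \<longleftrightarrow> (\<forall>k. ?G k = 0)"
    using \<alpha>(1) by (simp add: fun_eq_iff F_op_eq[of c \<omega> \<alpha> \<beta>, OF c(1) \<alpha>(2)])
  have G0: "?G 0 = 0"
    using ell1_zero_index[OF ell1_nlin(1)[OF boxD(3)[OF b]]] by (simp add: c unit_seq_def)
  have G1: "?G 1 = 0 \<longleftrightarrow> \<omega> + cos \<omega> + \<epsilon> * Re (nlin \<omega> c 1) = \<omega> \<and> sin \<omega> - \<epsilon> * Im (nlin \<omega> c 1) = \<beta>"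
    by (auto simp: complex_eq_iff unit_seq_def c Re_exp Im_exp algebra_simps)
  have G2: "?G k = 0 \<longleftrightarrow> - of_real \<epsilon> * nlin \<omega> c k / diag \<omega> \<beta> k = c k" if k: "2 \<le> k" for k
  proof -
    have "diag \<omega> \<beta> k \<noteq> 0" using norm_diag_ge_in_box(2)[OF b k] by auto
    then have "- of_real \<epsilon> * nlin \<omega> c k / diag \<omega> \<beta> k = c k \<longleftrightarrow> - of_real \<epsilon> * nlin \<omega> c k = diag \<omega> \<beta> k * c k"
      by (simp only: divide_eq_eq mult.commute not_False_eq_True if_True)
    also have "\<dots> \<longleftrightarrow> ?G k = 0"
      using k by (auto simp: unit_seq_def add_eq_0_iff2)
    finally show ?thesis by simp
  qed
  have "(\<forall>k. ?G k = 0) \<longleftrightarrow> ?G 1 = 0 \<and> (\<forall>k\<ge>2. ?G k = 0)"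
    using G0 by (metis One_nat_def less_2_cases not_le)
  also have "(\<forall>k\<ge>2. ?G k = 0) \<longleftrightarrow> (\<lambda>k. if k < 2 then 0 else - of_real \<epsilon> * nlin \<omega> c k / diag \<omega> \<beta> k) = c"
    using G2 c by (auto simp: fun_eq_iff less_2_cases_iff)
  finally show ?thesis unfolding F G1 by (simp add: picard_step_def)
qed

section \<open>Equations for the fixed point\<close>

text \<open>The tail keeps its indices and is padded with zeros, so that the lemmas on
  \<open>ell1\<close>, \<open>opL\<close> and \<open>conv\<close> apply to it directly.\<close>

definition tail_seq :: "nat \<Rightarrow> (nat \<Rightarrow> complex) \<Rightarrow> nat \<Rightarrow> complex" where
  "tail_seq n a = (\<lambda>k. if k < n then 0 else a k)"

lemma ell1_cut:
  assumes "a \<in> ell1"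
  shows "tail_seq n a \<in> ell1" "ell1_norm (tail_seq n a) \<le> ell1_norm a"
proof -
  have "tail_seq n a 0 = 0" using ell1_zero_index[OF assms] by (simp add: tail_seq_def)
  from ell1_dominated[of a "tail_seq n a" 1, OF assms this]
  show "tail_seq n a \<in> ell1" "ell1_norm (tail_seq n a) \<le> ell1_norm a" by (simp_all add: tail_seq_def)
qed

lemma ell1_norm_cut_Suc:
  assumes a: "a \<in> ell1" and n: "1 \<le> n"
  shows "ell1_norm (tail_seq n a) = 2 * cmod (a n) + ell1_norm (tail_seq (Suc n) a)"
proof -
  have eq: "cmod (a n * unit_seq n k) + cmod (tail_seq (Suc n) a k) = cmod (tail_seq n a k)" for k
    by (auto simp: tail_seq_def unit_seq_def less_Suc_eq)
  have "((\<lambda>k. cmod (a n * unit_seq n k) + cmod (tail_seq (Suc n) a k)) has_sum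
      (ell1_norm (\<lambda>k. a n * unit_seq n k) / 2 + ell1_norm (tail_seq (Suc n) a) / 2)) {1..}"
    by (rule has_sum_add[OF ell1_has_sum[OF ell1_unit(1)[OF n]] ell1_has_sum[OF ell1_cut(1)[OF a]]])
  then have "((\<lambda>k. cmod (tail_seq n a k)) has_sum
      (ell1_norm (\<lambda>k. a n * unit_seq n k) / 2 + ell1_norm (tail_seq (Suc n) a) / 2)) {1..}"
    by (simp only: eq)
  from has_sum_unique[OF this ell1_has_sum[OF ell1_cut(1)[OF a]]]
  show ?thesis by (simp add: ell1_unit(2)[OF n])
qed

lemma ell1_norm_cut_dominated:
  assumes b: "b \<in> ell1" and a: "a 0 = 0"
    and le: "\<And>k. n \<le> k \<Longrightarrow> cmod (a k) \<le> C * cmod (b k)"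
  shows "ell1_norm (tail_seq n a) \<le> C * ell1_norm (tail_seq n b)"
proof (rule ell1_dominated(2)[OF ell1_cut(1)[OF b]])
  show "tail_seq n a 0 = 0" using a by (simp add: tail_seq_def)
  show "cmod (tail_seq n a k) \<le> C * cmod (tail_seq n b k)" for k
    using le by (simp add: tail_seq_def)
qed

section \<open>Explicit coefficients at \<omega> = \<pi>/2, \<beta> = 1\<close>

lemma exp_quarter: "exp (- \<i> * of_nat k * of_real (pi / 2)) = (- \<i>) ^ k"
proof -
  have "exp (- \<i> * of_real (pi / 2)) = - \<i>"
    by (simp add: complex_eq_iff Re_exp Im_exp)
  moreover have "exp (of_nat k * (- \<i> * of_real (pi / 2))) = exp (- \<i> * of_real (pi / 2)) ^ k"
    by (rule exp_of_nat_mult)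
  ultimately show ?thesis by (simp add: mult.assoc mult.left_commute)
qed

text \<open>All phases at \<pi>/2 are powers of -i. Every coefficient below is therefore an explicit
  number plus an error linear in |\<omega> - \<pi>/2|.\<close>

lemma norm_exp_minus_quarter:
  "cmod (exp (- \<i> * of_nat k * of_real \<omega>) - (- \<i>) ^ k) \<le> k * \<bar>\<omega> - pi / 2\<bar>"
  using norm_exp_minus_diff[of k \<omega> "pi / 2"] by (simp only: exp_quarter)

lemma norm_exp_plus_quarter: "cmod (exp (\<i> * of_real \<omega>) - \<i>) \<le> \<bar>\<omega> - pi / 2\<bar>"
proof -
  have "exp (\<i> * of_real (pi / 2)) = \<i>" by (simp add: complex_eq_iff Re_exp Im_exp)
  with norm_exp_i_diff[of \<omega> "pi / 2"] show ?thesis by simp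
qed

lemma diag_quarter: "diag (pi / 2) 1 k = \<i> * of_nat k + (- \<i>) ^ k"
  by (simp only: diag_def exp_quarter) simp

lemma sqrt_2_less: "sqrt 2 < 14143/10000"
  by (rule real_less_lsqrt) (simp_all add: power2_eq_square)

lemma sqrt_5_greater: "2236/1000 < sqrt 5"
  by (rule real_less_rsqrt) (simp add: power2_eq_square)

text \<open>The value at the centre is |2i - 1| = sqrt 5. Using real and imaginary part improves on
  the 2 of \<open>norm_diag_2_ge\<close> as soon as \<omega> and \<beta> are known well.\<close>

lemma norm_diag_2_ge_quarter:
  "2236/1000 - 2 * (\<bar>\<beta> - 1\<bar> + \<bar>\<omega> - pi / 2\<bar>) \<le> cmod (diag \<omega> \<beta> 2)"
proof -
  have "cmod (diag (pi / 2) 1 2) = sqrt 5"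
    by (simp add: diag_quarter cmod_def)
  moreover have "cmod (diag (pi / 2) 1 2) \<le> cmod (diag \<omega> \<beta> 2) + cmod (diag \<omega> \<beta> 2 - diag (pi / 2) 1 2)"
    by (metis norm_minus_commute norm_triangle_sub)
  moreover have "cmod (diag \<omega> \<beta> 2 - diag (pi / 2) 1 2) \<le> 2 * (\<bar>\<beta> - 1\<bar> + \<bar>\<omega> - pi / 2\<bar>)"
    using norm_diag_diff[of \<omega> \<beta> 2 "pi / 2" 1] by simp
  ultimately show ?thesis using sqrt_5_greater by linarith
qed

text \<open>At the centre the modulus is exactly 4 for k = 3 and k = 5, larger for k = 4 and at
  least 5 from k = 6 on. The perturbation grows like k, so it is compared with the centre only for k
  \<le> 5; beyond that the growth of k \<beta> - 1 takes over.\<close>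

lemma norm_diag_ge_quarter:
  assumes k: "3 \<le> k" and small: "\<bar>\<beta> - 1\<bar> + \<bar>\<omega> - pi / 2\<bar> \<le> 1"
  shows "4 - 5 * (\<bar>\<beta> - 1\<bar> + \<bar>\<omega> - pi / 2\<bar>) \<le> cmod (diag \<omega> \<beta> k)"
proof (cases "k \<le> 5")
  case True
  with k have "k = 3 \<or> k = 4 \<or> k = 5" by auto
  then have "4 \<le> cmod (diag (pi / 2) 1 k)"
  proof (elim disjE)
    assume "k = 4"
    then have "Im (diag (pi / 2) 1 k) = 4" by (simp add: diag_quarter eval_nat_numeral)
    then show ?thesis using abs_Im_le_cmod[of "diag (pi / 2) 1 k"] by simp
  next
    assume "k = 3"
    then have "Im (diag (pi / 2) 1 k) = 4" by (simp add: diag_quarter eval_nat_numeral)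
    then show ?thesis using abs_Im_le_cmod[of "diag (pi / 2) 1 k"] by simp
  next
    assume "k = 5"
    then have "Im (diag (pi / 2) 1 k) = 4" by (simp add: diag_quarter eval_nat_numeral)
    then show ?thesis using abs_Im_le_cmod[of "diag (pi / 2) 1 k"] by simp
  qed
  moreover have "cmod (diag (pi / 2) 1 k) \<le> cmod (diag \<omega> \<beta> k) + cmod (diag \<omega> \<beta> k - diag (pi / 2) 1 k)"
    by (metis norm_minus_commute norm_triangle_sub)
  moreover have "k * (\<bar>\<beta> - 1\<bar> + \<bar>\<omega> - pi / 2\<bar>) \<le> 5 * (\<bar>\<beta> - 1\<bar> + \<bar>\<omega> - pi / 2\<bar>)"
    using True by (intro mult_right_mono) auto
  ultimately show ?thesis using norm_diag_diff[of \<omega> \<beta> k "pi / 2" 1] by linarith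
next
  case False
  then have k6: "6 \<le> real k" by simp
  have b: "0 \<le> \<beta>" using small by argo
  have "6 * \<beta> \<le> k * \<beta>" by (rule mult_right_mono[OF k6 b])
  with norm_diag_ge[of k \<beta> \<omega>] small show ?thesis by argo
qed

lemma norm_exp_12_le: "cmod (exp (- \<i> * of_real \<omega>) + exp (- \<i> * 2 * of_real \<omega>)) \<le> 14143/10000 + 3 * \<bar>\<omega> - pi / 2\<bar>"
proof -
  have "cmod (- \<i> - 1) = sqrt 2" by (simp add: cmod_def)
  moreover have "exp (- \<i> * of_real \<omega>) + exp (- \<i> * 2 * of_real \<omega>)
      = (- \<i> - 1) + ((exp (- \<i> * of_nat 1 * of_real \<omega>) - (- \<i>) ^ 1) + (exp (- \<i> * of_nat 2 * of_real \<omega>) - (- \<i>) ^ 2))"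
    by simp
  ultimately show ?thesis
    using norm_triangle_ineq[of "- \<i> - 1" "(exp (- \<i> * of_nat 1 * of_real \<omega>) - (- \<i>) ^ 1) + (exp (- \<i> * of_nat 2 * of_real \<omega>) - (- \<i>) ^ 2)"]
      norm_triangle_ineq[of "exp (- \<i> * of_nat 1 * of_real \<omega>) - (- \<i>) ^ 1" "exp (- \<i> * of_nat 2 * of_real \<omega>) - (- \<i>) ^ 2"]
      norm_exp_minus_quarter[of 1 \<omega>] norm_exp_minus_quarter[of 2 \<omega>] sqrt_2_less
    by (simp only: of_nat_numeral of_nat_1; linarith)
qed

lemma norm_exp_plus_12_diff:
  "cmod (exp (\<i> * of_real \<omega>) + exp (- \<i> * 2 * of_real \<omega>) - (\<i> - 1)) \<le> 3 * \<bar>\<omega> - pi / 2\<bar>"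
proof -
  have e: "exp (\<i> * of_real \<omega>) + exp (- \<i> * 2 * of_real \<omega>) - (\<i> - 1)
      = (exp (\<i> * of_real \<omega>) - \<i>) + (exp (- \<i> * of_nat 2 * of_real \<omega>) - (- \<i>) ^ 2)"
    by simp
  show ?thesis
    unfolding e
    using norm_triangle_ineq[of "exp (\<i> * of_real \<omega>) - \<i>" "exp (- \<i> * of_nat 2 * of_real \<omega>) - (- \<i>) ^ 2"]
      norm_exp_minus_quarter[of 2 \<omega>] norm_exp_plus_quarter[of \<omega>]
    unfolding of_nat_numeral by argo
qed

lemma norm_i_minus_1: "cmod (\<i> - 1) < 14143/10000"
  using sqrt_2_less by (simp add: cmod_def)

lemma norm_exp_plus_12_le:
  "cmod (exp (\<i> * of_real \<omega>) + exp (- \<i> * 2 * of_real \<omega>)) \<le> 14143/10000 + 3 * \<bar>\<omega> - pi / 2\<bar>"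
  using norm_exp_plus_12_diff[of \<omega>] norm_i_minus_1
    norm_triangle_sub[of "exp (\<i> * of_real \<omega>) + exp (- \<i> * 2 * of_real \<omega>)" "\<i> - 1"]
  by linarith

text \<open>-i and (-i)^3 cancel, so \<open>c 3\<close> feeds the tail from index 4 on only with a
  small factor.\<close>

lemma norm_exp_13_le: "cmod (exp (- \<i> * of_real \<omega>) + exp (- \<i> * 3 * of_real \<omega>)) \<le> 4 * \<bar>\<omega> - pi / 2\<bar>"
proof -
  have "exp (- \<i> * of_real \<omega>) + exp (- \<i> * 3 * of_real \<omega>)
      = (exp (- \<i> * of_nat 1 * of_real \<omega>) - (- \<i>) ^ 1) + (exp (- \<i> * of_nat 3 * of_real \<omega>) - (- \<i>) ^ 3)"
    by (simp add: eval_nat_numeral)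
  then show ?thesis
    using norm_triangle_ineq[of "exp (- \<i> * of_nat 1 * of_real \<omega>) - (- \<i>) ^ 1" "exp (- \<i> * of_nat 3 * of_real \<omega>) - (- \<i>) ^ 3"]
      norm_exp_minus_quarter[of 1 \<omega>] norm_exp_minus_quarter[of 3 \<omega>]
    by (simp only: of_nat_numeral of_nat_1; linarith)
qed

locale fixed_point =
  fixes \<epsilon> \<omega> \<beta> :: real and c :: "nat \<Rightarrow> complex"
  assumes in_box: "(\<omega>, \<beta>, c) \<in> search_box"
    and fixed: "picard_step \<epsilon> (\<omega>, \<beta>, c) = (\<omega>, \<beta>, c)"
    and eps: "0 < \<epsilon>" "\<epsilon> \<le> 1/10"
begin

lemmas bx = boxD[OF in_box]

abbreviation "\<theta> \<equiv> \<bar>\<omega> - pi / 2\<bar>"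
abbreviation "\<eta> \<equiv> \<bar>\<beta> - 1\<bar> + \<bar>\<omega> - pi / 2\<bar>"
abbreviation "g \<equiv> nlin \<omega> c"
abbreviation "q \<equiv> conv (opU \<omega> c) c"
abbreviation "A \<equiv> cmod (c 2)"
abbreviation "B \<equiv> cmod (c 3)"
text \<open>Halving undoes the factor 2 of \<open>ell1_norm\<close>: \<open>s\<close>,
  \<open>r\<close> and \<open>v\<close> are one-sided sums from index 2, 3 and 4. In the end
  \<open>A\<close> and \<open>s\<close> are of order \<epsilon>, \<open>B\<close> and
  \<open>r\<close> of order \<epsilon>^2, \<open>v\<close> of order \<epsilon>^3.\<close>

abbreviation "s \<equiv> ell1_norm c / 2"
abbreviation "r \<equiv> ell1_norm (tail_seq 3 c) / 2"
abbreviation "v \<equiv> ell1_norm (tail_seq 4 c) / 2"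

lemma cos_eq: "cos \<omega> = - \<epsilon> * Re (g 1)"
  and beta_eq: "\<beta> = sin \<omega> - \<epsilon> * Im (g 1)"
  using fixed by (simp_all add: picard_step_def)

lemma diag_mult_eq:
  assumes "2 \<le> k"
  shows "diag \<omega> \<beta> k * c k = - of_real \<epsilon> * g k"
proof -
  have "(\<lambda>k. if k < 2 then 0 else - of_real \<epsilon> * g k / diag \<omega> \<beta> k) = c"
    using fixed by (simp add: picard_step_def)
  from fun_cong[OF this, of k] assms have "- of_real \<epsilon> * g k / diag \<omega> \<beta> k = c k" by simp
  moreover have "diag \<omega> \<beta> k \<noteq> 0" using norm_diag_ge_in_box(2)[OF in_box assms] by auto
  ultimately show ?thesis by (metis nonzero_divide_eq_eq mult.commute)
qed

lemma s_eq: "s = A + r" and r_eq: "r = B + v"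
proof -
  have "tail_seq 2 c = c" using bx(4,5) by (auto simp: tail_seq_def fun_eq_iff less_2_cases_iff)
  then show "s = A + r" using ell1_norm_cut_Suc[OF bx(3), of 2] by (simp add: numeral_3_eq_3 numeral_2_eq_2)
  show "r = B + v" using ell1_norm_cut_Suc[OF bx(3), of 3] by simp
qed

lemma nonneg: "0 \<le> s" "0 \<le> r" "0 \<le> v"
  by (simp_all add: ell1_norm_nonneg)

lemma tail_le:
  assumes n: "2 \<le> n" and m: "0 < m" "\<And>k. n \<le> k \<Longrightarrow> m \<le> cmod (diag \<omega> \<beta> k)"
  shows "m * ell1_norm (tail_seq n c) \<le> \<epsilon> * ell1_norm (tail_seq n g)"
proof -
  have "ell1_norm (tail_seq n c) \<le> (\<epsilon> / m) * ell1_norm (tail_seq n g)"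
  proof (rule ell1_norm_cut_dominated[of g c, OF ell1_nlin(1)[OF bx(3)] bx(4)])
    fix k assume k: "n \<le> k"
    have "m * cmod (c k) \<le> cmod (diag \<omega> \<beta> k) * cmod (c k)" by (rule mult_right_mono[OF m(2)[OF k]]) simp
    also have "\<dots> = \<epsilon> * cmod (g k)"
      using arg_cong[OF diag_mult_eq[of k], of cmod] k n eps by (simp add: norm_mult)
    finally show "cmod (c k) \<le> (\<epsilon> / m) * cmod (g k)"
      using m(1) by (simp add: field_simps)
  qed
  then show ?thesis using m(1) by (simp add: field_simps)
qed

text \<open>Beyond an index n \<ge> 2 the term e_2 is gone and the linear coupling reaches back by
  one index only. So \<open>c n\<close> enters with its exact coefficient, and the bound 4 for
  \<open>opL\<close> is spent on the tail alone.\<close>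

lemma nlin_tail:
  assumes n: "2 \<le> n"
  shows "ell1_norm (tail_seq (Suc n) g)
    \<le> 2 * cmod (exp (- \<i> * of_real \<omega>) + exp (- \<i> * of_nat n * of_real \<omega>)) * cmod (c n)
      + 4 * ell1_norm (tail_seq (Suc n) c) + (ell1_norm c)\<^sup>2"
proof -
  define z where "z = (exp (- \<i> * of_real \<omega>) + exp (- \<i> * of_nat n * of_real \<omega>)) * c n"
  define h where "h = (\<lambda>k. z * unit_seq (Suc n) k + (opL \<omega> (tail_seq (Suc n) c) k + q k))"
  note U = ell1_unit[of "Suc n" z]
  note L = ell1_opL[OF ell1_cut(1)[OF bx(3)], of \<omega> "Suc n"]
  note Q = ell1_conv[OF ell1_opU(1)[OF bx(3)] bx(3), of \<omega>]
  note LQ = ell1_add[OF L(1) Q(1)]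
  have Um: "(\<lambda>k. z * unit_seq (Suc n) k) \<in> ell1" using U by simp
  note H = ell1_add[OF Um LQ(1), folded h_def]
  have "tail_seq (Suc n) g = tail_seq (Suc n) h"
  proof (rule ext)
    fix k show "tail_seq (Suc n) g k = tail_seq (Suc n) h k"
    proof (cases "k < Suc n")
      case False
      then have k: "1 \<le> k" "k \<noteq> 1" "k \<noteq> 2" using n by auto
      show ?thesis
        using False k n by (auto simp: tail_seq_def h_def nlin_def opL_expand z_def unit_seq_def)
    qed (simp add: tail_seq_def)
  qed
  then have "ell1_norm (tail_seq (Suc n) g) \<le> ell1_norm h" using ell1_cut(2)[OF H(1), of "Suc n"] by simp
  also have "\<dots> \<le> 2 * cmod z + (4 * ell1_norm (tail_seq (Suc n) c) + ell1_norm c * ell1_norm c)"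
    using H(2) LQ(2) U(2) L(2) Q(2) ell1_opU(2)[OF bx(3), of \<omega>] by simp
  finally show ?thesis by (simp add: z_def norm_mult power2_eq_square)
qed

lemma norm_q_le: "cmod (q k) \<le> 2 * s\<^sup>2"
proof -
  note Q = ell1_conv[OF ell1_opU(1)[OF bx(3)] bx(3), of \<omega>]
  show ?thesis
    using norm_le_ell1_norm[OF Q(1), of k] Q(2) ell1_opU(2)[OF bx(3), of \<omega>]
    by (simp add: power2_eq_square)
qed

text \<open>Split \<open>c\<close> into its component 2 and the tail \<open>t\<close>. The product
  of component 2 with itself vanishes off k = 4 by \<open>conv_unit_2\<close>; the two products that
  remain contain \<open>t\<close>, hence the factor \<open>r\<close> in place of a second factor of
  order \<epsilon>.\<close>

lemma norm_q_le_tail: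
  assumes S: "\<And>k. cmod (c k) \<le> S" and k: "k \<noteq> 4"
  shows "cmod (q k) \<le> 4 * r * S"
proof -
  define h where "h = (\<lambda>k. c 2 * unit_seq 2 k)"
  define t where "t = tail_seq 3 c"
  have hm: "h \<in> ell1" unfolding h_def by (rule ell1_unit) simp
  have tm: "t \<in> ell1" unfolding t_def by (rule ell1_cut(1)[OF bx(3)])
  have c: "c = (\<lambda>k. h k - (- t k))"
    using bx(4,5) by (auto simp: fun_eq_iff h_def t_def tail_seq_def unit_seq_def numeral_3_eq_3 numeral_2_eq_2 less_Suc_eq)
  have tc: "t = (\<lambda>k. c k - h k)" by (subst c) simp
  have Uh: "opU \<omega> h = (\<lambda>k. (exp (- \<i> * 2 * of_real \<omega>) * c 2) * unit_seq 2 k)"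
    by (auto simp: opU_def h_def unit_seq_def fun_eq_iff)
  note Uc = ell1_opU(1)[OF bx(3), of \<omega>] and Uhm = ell1_opU(1)[OF hm, of \<omega>] and Utm = ell1_opU(1)[OF tm, of \<omega>]
  have "opU \<omega> t = (\<lambda>k. opU \<omega> c k - opU \<omega> h k)" unfolding tc by (rule opU_diff)
  then have 1: "conv (opU \<omega> t) c k = q k - conv (opU \<omega> h) c k"
    using conv_diff_left[OF Uc Uhm bx(3), of k] by simp
  have 2: "conv (opU \<omega> h) t k = conv (opU \<omega> h) c k - conv (opU \<omega> h) h k"
    using conv_diff_right[OF Uhm bx(3) hm, of k] unfolding tc .
  have 3: "conv (opU \<omega> h) h k = 0"
    unfolding Uh unfolding h_def by (rule conv_unit_2[OF k])
  have S0: "0 \<le> S" using order_trans[OF norm_ge_zero S] .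
  have "cmod (opU \<omega> h k) \<le> S" for k
    unfolding norm_opU using S[of 2] S0 by (simp add: h_def unit_seq_def norm_mult)
  from norm_conv_le_left[OF Uhm tm this, of k]
  have "cmod (conv (opU \<omega> h) t k) \<le> S * (2 * r)" by (simp add: t_def)
  moreover have "cmod (conv (opU \<omega> t) c k) \<le> (2 * r) * S"
    using norm_conv_le_right[OF Utm bx(3) S, of k] ell1_opU(2)[OF tm, of \<omega>] by (simp add: t_def)
  moreover have "q k = conv (opU \<omega> t) c k + conv (opU \<omega> h) t k" using 1 2 3 by simp
  ultimately show ?thesis
    using norm_triangle_ineq[of "conv (opU \<omega> t) c k" "conv (opU \<omega> h) t k"]
    by (simp add: algebra_simps)
qed

end

lemma le_of_mult_le:
  fixes m :: real
  assumes "m * x \<le> y" "m0 \<le> m" "0 < m0" "0 \<le> x" "y \<le> m0 * z"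
  shows "x \<le> z"
proof -
  have "m0 * x \<le> m * x" using assms by (intro mult_right_mono)
  with assms have "m0 * x \<le> m0 * z" by linarith
  with assms(3) show ?thesis by simp
qed

lemma square_le_scaled:
  fixes e :: real
  assumes "0 \<le> s" "s \<le> S * e" "0 \<le> e" "e \<le> 1/10"
  shows "s\<^sup>2 \<le> S\<^sup>2 / 10 * e" "s\<^sup>2 \<le> S\<^sup>2 * e\<^sup>2"
proof -
  show *: "s\<^sup>2 \<le> S\<^sup>2 * e\<^sup>2"
    using power_mono[OF assms(2,1), of 2] by (simp add: power_mult_distrib)
  have "e * e \<le> 1/10 * e" using assms by (intro mult_right_mono) auto
  then have "S\<^sup>2 * e\<^sup>2 \<le> S\<^sup>2 * (1/10 * e)" by (intro mult_left_mono) (auto simp: power2_eq_square)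
  with * show "s\<^sup>2 \<le> S\<^sup>2 / 10 * e" by simp
qed

text \<open>One turn of the bootstrap for a tail: ingredients of order j, among them the previous
  bound \<open>R\<close> of the tail itself, give order j + 1 because the right-hand side carries a
  factor e. What remains to be checked is the numerical premise on \<open>K\<close>.\<close>

lemma tail_arith:
  fixes e :: real
  assumes h: "m * r \<le> e * (P * A + 4 * r + 2 * s\<^sup>2)" and m: "m0 \<le> m" "0 < m0"
    and e: "0 \<le> e" "e \<le> 1/10" and P: "0 \<le> P" "P \<le> P0" and A: "0 \<le> A" "A \<le> A0 * e ^ j"
    and r: "0 \<le> r" "r \<le> R * e ^ j" and s: "2 * s\<^sup>2 \<le> Q * e ^ j"
    and K: "P0 * A0 + 4 * R + Q \<le> m0 * K" and n: "n = Suc j"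
  shows "r \<le> K * e ^ n"
proof (rule le_of_mult_le[OF h m r(1)])
  have "P * A \<le> P0 * (A0 * e ^ j)" using P A by (intro mult_mono) auto
  with r(2) s have "P * A + 4 * r + 2 * s\<^sup>2 \<le> (P0 * A0 + 4 * R + Q) * e ^ j"
    by (simp add: algebra_simps)
  also have "\<dots> \<le> (m0 * K) * e ^ j" using K e by (intro mult_right_mono) auto
  finally have "e * (P * A + 4 * r + 2 * s\<^sup>2) \<le> e * ((m0 * K) * e ^ j)"
    using e by (intro mult_left_mono)
  then show "e * (P * A + 4 * r + 2 * s\<^sup>2) \<le> m0 * (K * e ^ n)" by (simp add: n mult_ac)
qed

context fixed_point
begin

section \<open>Inequalities for single components and tails\<close>

lemma r_ineq:
  assumes m: "0 < m" "\<And>k. 3 \<le> k \<Longrightarrow> m \<le> cmod (diag \<omega> \<beta> k)"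
  shows "m * r \<le> \<epsilon> * (cmod (exp (- \<i> * of_real \<omega>) + exp (- \<i> * 2 * of_real \<omega>)) * A + 4 * r + 2 * s\<^sup>2)"
proof -
  have "m * ell1_norm (tail_seq 3 c) \<le> \<epsilon> * ell1_norm (tail_seq 3 g)" using m by (intro tail_le) auto
  also have "\<dots> \<le> \<epsilon> * (2 * cmod (exp (- \<i> * of_real \<omega>) + exp (- \<i> * of_nat 2 * of_real \<omega>)) * cmod (c 2)
      + 4 * ell1_norm (tail_seq 3 c) + (ell1_norm c)\<^sup>2)"
    using nlin_tail[of 2] eps by (intro mult_left_mono) auto
  finally show ?thesis by (simp add: power2_eq_square algebra_simps)
qed

lemma v_ineq:
  assumes m: "0 < m" "\<And>k. 3 \<le> k \<Longrightarrow> m \<le> cmod (diag \<omega> \<beta> k)"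
  shows "m * v \<le> \<epsilon> * (cmod (exp (- \<i> * of_real \<omega>) + exp (- \<i> * 3 * of_real \<omega>)) * B + 4 * v + 2 * s\<^sup>2)"
proof -
  have "m * ell1_norm (tail_seq 4 c) \<le> \<epsilon> * ell1_norm (tail_seq 4 g)" using m by (intro tail_le) auto
  also have "\<dots> \<le> \<epsilon> * (2 * cmod (exp (- \<i> * of_real \<omega>) + exp (- \<i> * of_nat 3 * of_real \<omega>)) * cmod (c 3)
      + 4 * ell1_norm (tail_seq 4 c) + (ell1_norm c)\<^sup>2)"
    using nlin_tail[of 3] eps by (intro mult_left_mono) auto
  finally show ?thesis by (simp add: power2_eq_square algebra_simps)
qed

lemma g2_eq: "g 2 = exp (- \<i> * of_real \<omega>) + ((exp (\<i> * of_real \<omega>) + exp (- \<i> * of_nat 3 * of_real \<omega>)) * c 3 + q 2)"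
  using opL_expand[of 2 \<omega> c] bx(5) by (simp add: nlin_def unit_seq_def)

lemma norm_g2_rest_le:
  "cmod ((exp (\<i> * of_real \<omega>) + exp (- \<i> * of_nat 3 * of_real \<omega>)) * c 3 + q 2) \<le> 2 * B + cmod (q 2)"
  using mult_right_mono[OF norm_exp_sum_le_2[of \<omega> 3 \<omega>], of B]
  by (intro norm_triangle_le) (simp add: norm_mult)

lemma A_ineq: "cmod (diag \<omega> \<beta> 2) * A \<le> \<epsilon> * (1 + (2 * B + cmod (q 2)))"
proof -
  have "cmod (diag \<omega> \<beta> 2) * A = \<epsilon> * cmod (g 2)"
    using arg_cong[OF diag_mult_eq[of 2], of cmod] eps by (simp add: norm_mult)
  also have "cmod (g 2) \<le> 1 + (2 * B + cmod (q 2))"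
    unfolding g2_eq by (rule norm_triangle_mono[OF _ norm_g2_rest_le]) (simp add: norm_exp_eq_Re)
  finally show ?thesis using eps by simp
qed

lemma B_ineq: "cmod (diag \<omega> \<beta> 3) * B
  \<le> \<epsilon> * (cmod (exp (- \<i> * of_real \<omega>) + exp (- \<i> * 2 * of_real \<omega>)) * A + (2 * v + cmod (q 3)))"
proof -
  have "2 * cmod (c 4) \<le> 2 * v"
    using norm_le_ell1_norm[OF ell1_cut(1)[OF bx(3)], of 4 4] by (simp add: tail_seq_def)
  moreover have "cmod (exp (\<i> * of_real \<omega>) + exp (- \<i> * of_nat 4 * of_real \<omega>)) * cmod (c 4) \<le> 2 * cmod (c 4)"
    by (rule mult_right_mono[OF norm_exp_sum_le_2]) simp
  moreover have eq: "g 3 = (exp (- \<i> * of_real \<omega>) + exp (- \<i> * 2 * of_real \<omega>)) * c 2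
      + ((exp (\<i> * of_real \<omega>) + exp (- \<i> * of_nat 4 * of_real \<omega>)) * c 4 + q 3)"
    using opL_expand[of 3 \<omega> c] by (simp add: nlin_def unit_seq_def)
  ultimately have "cmod (g 3) \<le> cmod (exp (- \<i> * of_real \<omega>) + exp (- \<i> * 2 * of_real \<omega>)) * A + (2 * v + cmod (q 3))"
    unfolding eq by (intro norm_triangle_mono) (simp_all add: norm_mult)
  moreover have "cmod (diag \<omega> \<beta> 3) * B = \<epsilon> * cmod (g 3)"
    using arg_cong[OF diag_mult_eq[of 3], of cmod] eps by (simp add: norm_mult)
  ultimately show ?thesis using eps by simp
qed

section \<open>Component 1 and the leading terms\<close>

lemma g1_le: "cmod (g 1) \<le> cmod (exp (\<i> * of_real \<omega>) + exp (- \<i> * 2 * of_real \<omega>)) * A + cmod (q 1)"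
  unfolding nlin_1 by (intro norm_triangle_mono) (simp_all add: norm_mult)

lemma cos_le: "\<bar>cos \<omega>\<bar> \<le> \<epsilon> * cmod (g 1)"
  using abs_Re_le_cmod[of "g 1"] eps by (simp add: cos_eq abs_mult)

text \<open>Near \<pi>/2, cos \<omega> is - (\<omega> - \<pi>/2) up to a relative error of
  (35/1000)^2 / 2 < 1/1000, which the factor 1001/1000 absorbs.\<close>

lemma theta_le: "\<theta> \<le> 1001/1000 * (\<epsilon> * cmod (g 1))"
proof -
  have "\<bar>(\<omega> + cos \<omega>) - (pi / 2 + cos (pi / 2))\<bar> \<le> (35/1000)\<^sup>2 / 2 * \<theta>"
    by (rule add_cos_lipschitz) (use bx in auto)
  with cos_le show ?thesis unfolding cos_pi_half power2_eq_square by argo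
qed

lemma beta_le: "\<bar>\<beta> - 1\<bar> \<le> \<epsilon> * cmod (g 1) + \<theta>\<^sup>2 / 2"
proof -
  have "\<epsilon> * \<bar>Im (g 1)\<bar> \<le> \<epsilon> * cmod (g 1)"
    using abs_Im_le_cmod[of "g 1"] eps by simp
  then have "\<bar>\<epsilon> * Im (g 1)\<bar> \<le> \<epsilon> * cmod (g 1)" using eps by (simp add: abs_mult)
  with sin_near_half_pi[of \<omega> \<theta>] sin_le_one[of \<omega>] beta_eq show ?thesis by argo
qed

text \<open>The entry of \<open>c_bar\<close> at index 2: the solution of component 2 at \<omega> =
  \<pi>/2, \<beta> = 1 with \<open>c 3\<close> and the quadratic term dropped.\<close>

definition c2 :: complex where "c2 = (2 - \<i>) / 5 * of_real \<epsilon>"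

lemma norm_c2: "cmod c2 \<le> 4473/10000 * \<epsilon>"
proof -
  have "sqrt 5 \<le> 22365/10000" by (rule real_le_lsqrt) (simp_all add: power2_eq_square)
  moreover have "cmod (2 - \<i>) = sqrt 5" by (simp add: cmod_def)
  then have "cmod c2 = sqrt 5 * (\<epsilon> / 5)"
    using eps unfolding c2_def norm_mult norm_divide by simp
  ultimately show ?thesis using mult_right_mono[of "sqrt 5" "22365/10000" "\<epsilon> / 5"] eps by linarith
qed

text \<open>Subtract the model equation (2i - 1) \<open>c2\<close> = i \<epsilon> from component 2.
  The errors left are that of the phase (\<theta>), that of the diagonal (2 \<eta>, multiplied by
  |\<open>c2\<close>|, which is \<epsilon> / sqrt 5) and the neglected terms with \<open>c 3\<close>
  and \<open>q 2\<close>.\<close>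

lemma c2_ineq: "cmod (diag \<omega> \<beta> 2) * cmod (c 2 - c2) \<le> \<epsilon> * (\<theta> + 2 * \<eta> * (4473/10000) + (2 * B + cmod (q 2)))"
proof -
  let ?h = "(exp (\<i> * of_real \<omega>) + exp (- \<i> * of_nat 3 * of_real \<omega>)) * c 3 + q 2"
  have "(2 * \<i> - 1) * ((2 - \<i>) / 5) = \<i>" by (simp add: complex_eq_iff)
  moreover have "diag (pi / 2) 1 2 = 2 * \<i> - 1" by (simp add: diag_quarter)
  ultimately have c2: "diag (pi / 2) 1 2 * c2 = of_real \<epsilon> * \<i>"
    unfolding c2_def by (metis mult.assoc mult.commute)
  have eq: "diag \<omega> \<beta> 2 * (c 2 - c2) = - of_real \<epsilon> * ((exp (- \<i> * of_real \<omega>) - (- \<i>)) + ?h)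
      - (diag \<omega> \<beta> 2 - diag (pi / 2) 1 2) * c2"
    unfolding right_diff_distrib left_diff_distrib c2 diag_mult_eq[of 2, OF order_refl] g2_eq
    by (simp add: algebra_simps)
  have 1: "cmod (- of_real \<epsilon> * ((exp (- \<i> * of_real \<omega>) - (- \<i>)) + ?h))
      \<le> \<epsilon> * (\<theta> + (2 * B + cmod (q 2)))"
  proof -
    have "cmod ((exp (- \<i> * of_real \<omega>) - (- \<i>)) + ?h) \<le> \<theta> + (2 * B + cmod (q 2))"
      by (rule norm_triangle_mono[OF _ norm_g2_rest_le]) (use norm_exp_minus_quarter[of 1 \<omega>] in simp)
    then have "\<epsilon> * cmod ((exp (- \<i> * of_real \<omega>) - (- \<i>)) + ?h) \<le> \<epsilon> * (\<theta> + (2 * B + cmod (q 2)))"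
      using eps by (intro mult_left_mono) auto
    moreover have "cmod (- of_real \<epsilon> * z) = \<epsilon> * cmod z" for z
      using eps by (simp add: norm_mult)
    ultimately show ?thesis by (simp only:)
  qed
  have 2: "cmod ((diag \<omega> \<beta> 2 - diag (pi / 2) 1 2) * c2) \<le> (2 * \<eta>) * (4473/10000 * \<epsilon>)"
    unfolding norm_mult using norm_diag_diff[of \<omega> \<beta> 2 "pi / 2" 1] norm_c2
    by (intro mult_mono) auto
  have "cmod (diag \<omega> \<beta> 2) * cmod (c 2 - c2)
      \<le> \<epsilon> * (\<theta> + (2 * B + cmod (q 2))) + (2 * \<eta>) * (4473/10000 * \<epsilon>)"
    unfolding norm_mult[symmetric] eq by (rule order_trans[OF norm_triangle_ineq4 add_mono[OF 1 2]])
  then show ?thesis by (simp add: algebra_simps)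
qed

lemma g1_diff_le: "cmod (g 1 - (\<i> - 1) * c2) \<le> 3 * \<theta> * A + (14143/10000 * cmod (c 2 - c2) + cmod (q 1))"
proof -
  let ?P = "exp (\<i> * of_real \<omega>) + exp (- \<i> * 2 * of_real \<omega>)"
  have eq: "g 1 - (\<i> - 1) * c2 = (?P - (\<i> - 1)) * c 2 + ((\<i> - 1) * (c 2 - c2) + q 1)"
    unfolding nlin_1 by (simp add: algebra_simps)
  show ?thesis
    unfolding eq
  proof (intro norm_triangle_mono order_refl)
    show "cmod ((?P - (\<i> - 1)) * c 2) \<le> 3 * \<theta> * A"
      unfolding norm_mult by (rule mult_right_mono[OF norm_exp_plus_12_diff]) simp
    show "cmod ((\<i> - 1) * (c 2 - c2)) \<le> 14143/10000 * cmod (c 2 - c2)"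
      unfolding norm_mult using norm_i_minus_1 by (intro mult_right_mono) auto
  qed
qed

text \<open>The coefficients 1/5 and 3/5 are those of (i - 1) \<open>c2\<close> = (-1 + 3i)
  \<epsilon> / 5. Replacing cos \<omega> by - (\<omega> - \<pi>/2) and sin \<omega> by 1 causes the
  terms in \<theta>.\<close>

lemma frequency_error:
  "\<bar>\<omega> - omega_bar \<epsilon>\<bar> \<le> \<epsilon> * cmod (g 1 - (\<i> - 1) * c2) + \<theta>\<^sup>2 / 2 * \<theta>"
  "\<bar>\<beta> - (1 - 3 * \<epsilon>\<^sup>2 / 5)\<bar> \<le> \<epsilon> * cmod (g 1 - (\<i> - 1) * c2) + \<theta>\<^sup>2 / 2"
proof -
  let ?d = "g 1 - (\<i> - 1) * c2"
  have re: "\<epsilon> * Re ?d = - cos \<omega> + \<epsilon>\<^sup>2 / 5" and im: "\<epsilon> * Im ?d = sin \<omega> - \<beta> - 3 * \<epsilon>\<^sup>2 / 5"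
    using cos_eq beta_eq by (simp_all add: c2_def power2_eq_square algebra_simps)
  have "\<bar>\<epsilon> * Re ?d\<bar> \<le> \<epsilon> * cmod ?d" "\<bar>\<epsilon> * Im ?d\<bar> \<le> \<epsilon> * cmod ?d"
    unfolding abs_mult using abs_Re_le_cmod[of ?d] abs_Im_le_cmod[of ?d] eps by simp_all
  note d = this[unfolded re im]
  have "\<bar>(\<omega> + cos \<omega>) - (pi / 2 + cos (pi / 2))\<bar> \<le> \<theta>\<^sup>2 / 2 * \<theta>"
    by (rule add_cos_lipschitz) auto
  with d(1) show "\<bar>\<omega> - omega_bar \<epsilon>\<bar> \<le> \<epsilon> * cmod ?d + \<theta>\<^sup>2 / 2 * \<theta>"
    unfolding omega_bar_def cos_pi_half by argo
  from d(2) sin_near_half_pi[of \<omega> \<theta>, OF order_refl] sin_le_one[of \<omega>]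
  show "\<bar>\<beta> - (1 - 3 * \<epsilon>\<^sup>2 / 5)\<bar> \<le> \<epsilon> * cmod ?d + \<theta>\<^sup>2 / 2"
    by argo
qed

lemma norm_c_le:
  assumes "A \<le> S" "r \<le> S"
  shows "cmod (c k) \<le> S"
proof -
  have S0: "0 \<le> S" using order_trans[OF norm_ge_zero assms(1)] .
  show ?thesis
  proof (cases "k < 3")
    case True
    then have "k = 0 \<or> k = Suc 0 \<or> k = 2" by auto
    with assms(1) bx(4,5) S0 show ?thesis by auto
  next
    case False
    then have "cmod (c k) = cmod (tail_seq 3 c k)" by (simp add: tail_seq_def)
    also have "\<dots> \<le> r" using norm_le_ell1_norm[OF ell1_cut(1)[OF bx(3)], of 3 k] by simp
    finally show ?thesis using assms(2) by simp
  qed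
qed

end

section \<open>Bootstrapping\<close>

context fixed_point
begin

lemma eps_powers: "\<epsilon>\<^sup>2 \<le> \<epsilon> / 10" "\<epsilon> ^ 3 \<le> \<epsilon>\<^sup>2 / 10" "\<epsilon> ^ 4 \<le> \<epsilon>\<^sup>2 / 100" "0 \<le> \<epsilon>\<^sup>2" "0 \<le> \<epsilon> ^ 3" "0 \<le> \<epsilon> ^ 4"
proof -
  have *: "\<epsilon> ^ Suc n \<le> \<epsilon> ^ n / 10" for n
    using mult_right_mono[OF eps(2), of "\<epsilon> ^ n"] eps by simp
  from *[of 1] show "\<epsilon>\<^sup>2 \<le> \<epsilon> / 10" by (simp add: numeral_2_eq_2)
  from *[of 2] show **: "\<epsilon> ^ 3 \<le> \<epsilon>\<^sup>2 / 10" by (simp add: numeral_3_eq_3)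
  from *[of 3] ** show "\<epsilon> ^ 4 \<le> \<epsilon>\<^sup>2 / 100" by simp
qed (use eps in simp_all)

lemma times_eps:
  assumes "x \<le> a * \<epsilon> ^ n"
  shows "\<epsilon> * x \<le> a * \<epsilon> ^ Suc n"
  using mult_left_mono[OF assms, of \<epsilon>] eps by (simp add: mult_ac)

text \<open>200 = 2 * 100, from the 1/2 on the left and from \<epsilon>^4 \<le> \<epsilon>^2 /
  100.\<close>

lemma theta_square_le:
  assumes "\<theta> \<le> T * \<epsilon>\<^sup>2" "T * T \<le> 200 * K"
  shows "\<theta>\<^sup>2 / 2 \<le> K * \<epsilon>\<^sup>2"
proof -
  have "\<theta>\<^sup>2 \<le> (T * \<epsilon>\<^sup>2)\<^sup>2" using assms(1) by (rule power_mono) simp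
  also have "\<dots> = T * T * \<epsilon> ^ 4" by (simp add: power2_eq_square power4_eq_xxxx)
  also have "\<dots> \<le> T * T * (\<epsilon>\<^sup>2 / 100)" by (rule mult_left_mono[OF eps_powers(3)]) simp
  also have "\<dots> \<le> 200 * K * (\<epsilon>\<^sup>2 / 100)" by (rule mult_right_mono[OF assms(2)]) simp
  finally show ?thesis by simp
qed

lemma q_tail_le:
  assumes "A \<le> S * \<epsilon>" "r \<le> R * \<epsilon>\<^sup>2" "r \<le> S * \<epsilon>" "k \<noteq> 4"
  shows "cmod (q k) \<le> 4 * R * S * \<epsilon> ^ 3"
proof -
  have "r * (S * \<epsilon>) \<le> (R * \<epsilon>\<^sup>2) * (S * \<epsilon>)"
    using assms(2) order_trans[OF norm_ge_zero assms(1)] by (rule mult_right_mono)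
  with norm_q_le_tail[OF norm_c_le[OF assms(1,3)] assms(4)]
  show ?thesis by (simp add: power2_eq_square power3_eq_cube mult_ac)
qed

lemma A_arith:
  assumes "2 * B + cmod (q 2) \<le> x" "m \<le> cmod (diag \<omega> \<beta> 2)" "0 < m" "1 + x \<le> m * K"
  shows "A \<le> K * \<epsilon>"
proof (rule le_of_mult_le[OF A_ineq assms(2,3)])
  have "1 + (2 * B + cmod (q 2)) \<le> m * K" using assms by simp
  then show "\<epsilon> * (1 + (2 * B + cmod (q 2))) \<le> m * (K * \<epsilon>)"
    using mult_left_mono[of "1 + (2 * B + cmod (q 2))" "m * K" \<epsilon>] eps by (simp add: mult_ac)
qed simp

lemma g1_arith:
  assumes "\<theta> \<le> T" "A \<le> a * \<epsilon>" "cmod (q 1) \<le> x * \<epsilon>" "(14143/10000 + 3 * T) * a + x \<le> K"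
  shows "\<epsilon> * cmod (g 1) \<le> K * \<epsilon>\<^sup>2"
proof -
  have "cmod (exp (\<i> * of_real \<omega>) + exp (- \<i> * 2 * of_real \<omega>)) * A \<le> (14143/10000 + 3 * T) * (a * \<epsilon>)"
    using assms(1,2) order_trans[OF norm_exp_plus_12_le[of \<omega>], of "14143/10000 + 3 * T"] order_trans[OF abs_ge_zero assms(1)]
    by (intro mult_mono) auto
  with g1_le assms(3) have "cmod (g 1) \<le> ((14143/10000 + 3 * T) * a + x) * \<epsilon>"
    by (simp add: algebra_simps)
  also have "\<dots> \<le> K * \<epsilon> ^ 1" using assms(4) eps by simp
  finally show ?thesis using times_eps[of "cmod (g 1)" K 1] by (simp add: numeral_2_eq_2)
qed

lemma r_arith:
  assumes "0 < m" "\<And>k. 3 \<le> k \<Longrightarrow> m \<le> cmod (diag \<omega> \<beta> k)"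
    and "\<theta> \<le> T" "A \<le> a * \<epsilon>" "r \<le> R * \<epsilon>" "s \<le> S * \<epsilon>"
    and "(14143/10000 + 3 * T) * a + 4 * R + S\<^sup>2 / 5 \<le> m * K"
  shows "r \<le> K * \<epsilon>\<^sup>2"
proof (rule tail_arith[where j = 1 and P = "cmod (exp (- \<i> * of_real \<omega>) + exp (- \<i> * 2 * of_real \<omega>))"
      and ?P0.0 = "14143/10000 + 3 * T" and m = m and ?m0.0 = m and A = A and s = s and ?A0.0 = a and R = R and Q = "S\<^sup>2 / 5"])
  show "m * r \<le> \<epsilon> * (cmod (exp (- \<i> * of_real \<omega>) + exp (- \<i> * 2 * of_real \<omega>)) * A + 4 * r + 2 * s\<^sup>2)"
    by (rule r_ineq[OF assms(1,2)])
  show "cmod (exp (- \<i> * of_real \<omega>) + exp (- \<i> * 2 * of_real \<omega>)) \<le> 14143/10000 + 3 * T"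
    using norm_exp_12_le[of \<omega>] assms(3) by argo
  \<comment> \<open>The square is of order \<epsilon>^2; one power is spent as \<epsilon> \<le>
    1/10, which turns 2 S^2 into S^2 / 5.\<close>
  show "2 * s\<^sup>2 \<le> S\<^sup>2 / 5 * \<epsilon> ^ 1"
    using square_le_scaled(1)[OF nonneg(1) assms(6)] eps by simp
qed (use assms eps nonneg in auto)

lemma c2_arith:
  assumes "m \<le> cmod (diag \<omega> \<beta> 2)" "0 < m" "\<theta> \<le> T * \<epsilon>\<^sup>2" "\<eta> \<le> H * \<epsilon>\<^sup>2" "B \<le> b * \<epsilon>\<^sup>2" "cmod (q 2) \<le> x * \<epsilon>\<^sup>2"
    "T + 8946/10000 * H + 2 * b + x \<le> m * K"
  shows "cmod (c 2 - c2) \<le> K * \<epsilon> ^ 3"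
proof (rule le_of_mult_le[OF c2_ineq assms(1,2)])
  have "\<theta> + 2 * \<eta> * (4473/10000) + (2 * B + cmod (q 2)) \<le> (T + 8946/10000 * H + 2 * b + x) * \<epsilon>\<^sup>2"
    using assms(3-6) unfolding distrib_right mult.assoc by argo
  also have "\<dots> \<le> (m * K) * \<epsilon>\<^sup>2" using assms(7) by (intro mult_right_mono) auto
  finally show "\<epsilon> * (\<theta> + 2 * \<eta> * (4473/10000) + (2 * B + cmod (q 2))) \<le> m * (K * \<epsilon> ^ 3)"
    using times_eps[of _ "m * K" 2] by (simp add: numeral_3_eq_3 mult.assoc)
qed simp

lemma g1_diff_arith:
  assumes "\<theta> \<le> T * \<epsilon>\<^sup>2" "A \<le> a * \<epsilon>" "cmod (c 2 - c2) \<le> d * \<epsilon> ^ 3" "cmod (q 1) \<le> x * \<epsilon> ^ 3"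
    "3 * T * a + 14143/10000 * d + x \<le> K" "0 \<le> K"
  shows "\<epsilon> * cmod (g 1 - (\<i> - 1) * c2) \<le> K / 100 * \<epsilon>\<^sup>2"
proof -
  have "\<theta> * A \<le> (T * \<epsilon>\<^sup>2) * (a * \<epsilon>)"
    using assms(1,2) order_trans[OF abs_ge_zero assms(1)] by (intro mult_mono) auto
  with g1_diff_le assms(3,4)
  have "cmod (g 1 - (\<i> - 1) * c2) \<le> (3 * T * a + 14143/10000 * d + x) * \<epsilon> ^ 3"
    by (simp add: algebra_simps power2_eq_square power3_eq_cube)
  also have "\<dots> \<le> K * \<epsilon> ^ 3" using assms(5) eps by (intro mult_right_mono) auto
  finally have "\<epsilon> * cmod (g 1 - (\<i> - 1) * c2) \<le> K * \<epsilon> ^ 4"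
    using times_eps[of _ K 3] by simp
  also have "\<dots> \<le> K * (\<epsilon>\<^sup>2 / 100)" by (rule mult_left_mono[OF eps_powers(3) assms(6)])
  finally show ?thesis by simp
qed

text \<open>
  The constants in the next three lemmas are rounded outputs of iterating the a priori inequalities,
  starting from the size of the box. Only the powers of \<open>\<epsilon>\<close> improve at first; after the errors of
  \<open>\<omega>\<close> and \<open>\<beta>\<close> against their second order approximations are under control, the constants are
  within a few per cent of the true ones, which the radii of the theorem require.
\<close>
lemma coarse_bounds:
  "A \<le> 548/1000 * \<epsilon>" "r \<le> 49/100 * \<epsilon>\<^sup>2" "\<theta> \<le> 1173/1000 * \<epsilon>\<^sup>2" "\<eta> \<le> 2351/1000 * \<epsilon>\<^sup>2"
proof -
  have eta: "\<eta> \<le> 7/100" using bx(1,2) by argo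
  have m3: "365/100 \<le> cmod (diag \<omega> \<beta> k)" if "3 \<le> k" for k
    using norm_diag_ge_quarter[OF that, of \<beta> \<omega>] eta by argo
  have m2: "186/100 \<le> cmod (diag \<omega> \<beta> 2)" using norm_diag_2_ge[of \<beta> \<omega>] bx(1,2) by argo
  have mk: "186/100 \<le> cmod (diag \<omega> \<beta> k)" if "2 \<le> k" for k
    using m2 m3[of k] that by (cases "k = 2") auto
  have cc: "tail_seq 2 c = c" using bx(4,5) by (auto simp: tail_seq_def fun_eq_iff less_2_cases_iff)
  have "ell1_norm g \<le> 49/16"
    using ell1_nlin(2)[OF bx(3), of \<omega>] bx(8) power_mono[OF bx(8) ell1_norm_nonneg, of 2] by (simp add: power2_eq_square)
  with ell1_cut(2)[OF ell1_nlin(1)[OF bx(3)], of 2 \<omega>] have "ell1_norm (tail_seq 2 g) \<le> 49/16" by simp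
  then have "\<epsilon> * ell1_norm (tail_seq 2 g) \<le> \<epsilon> * (49/16)" using eps by (intro mult_left_mono) auto
  moreover have "186/100 * ell1_norm c \<le> \<epsilon> * ell1_norm (tail_seq 2 g)"
    using tail_le[of 2 "186/100", OF _ _ mk] unfolding cc by simp
  \<comment> \<open>824/1000 rounds up (49/16) / (2 * 1.86).\<close>
  ultimately have s0: "s \<le> 824/1000 * \<epsilon>" using eps by linarith
  have A0: "A \<le> 824/1000 * \<epsilon>" and r0: "r \<le> 824/1000 * \<epsilon>" using s0 s_eq nonneg norm_ge_zero[of "c 2"] by linarith+
  have B: "B \<le> r" using r_eq nonneg by linarith
  note T = bx(1)
  \<comment> \<open>Here \<open>r\<close> gains its second power of \<epsilon>: indices from 3 on
    are reached only through terms that already contain \<open>c\<close>. Feeding the improved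
    bounds for \<open>A\<close>, \<open>r\<close> and \<open>s\<close> back then lowers the
    constant.\<close>
  have r1: "r \<le> 14/10 * \<epsilon>\<^sup>2"
    by (rule r_arith[OF _ m3 T A0 r0 s0]) (simp_all add: power2_eq_square)
  have q0: "cmod (q k) \<le> 1358/10000 * \<epsilon>" for k
    using norm_q_le[of k] square_le_scaled(1)[OF nonneg(1) s0] eps by (simp add: power2_eq_square)
  have "2 * B + cmod (q 2) \<le> 416/10000" using q0[of 2] B r1 eps_powers(1) eps by linarith
  then have A1: "A \<le> 561/1000 * \<epsilon>" by (rule A_arith[OF _ m2]) simp_all
  have s1: "s \<le> 701/1000 * \<epsilon>" and r1': "r \<le> 14/100 * \<epsilon>" using s_eq A1 r1 eps_powers(1) by linarith+
  show r2: "r \<le> 49/100 * \<epsilon>\<^sup>2"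
    by (rule r_arith[OF _ m3 T A1 r1' s1]) (simp_all add: power2_eq_square)
  have s2: "s \<le> 61/100 * \<epsilon>" using s_eq A1 r2 eps_powers(1) by linarith
  have q2: "cmod (q k) \<le> 745/10000 * \<epsilon>" for k
    using norm_q_le[of k] square_le_scaled(1)[OF nonneg(1) s2] eps by (simp add: power2_eq_square)
  have "2 * B + cmod (q 2) \<le> 174/10000" using q2[of 2] B r2 eps_powers(1) eps by linarith
  then show A2: "A \<le> 548/1000 * \<epsilon>" by (rule A_arith[OF _ m2]) simp_all
  have g: "\<epsilon> * cmod (g 1) \<le> 1171/1000 * \<epsilon>\<^sup>2"
    by (rule g1_arith[OF T A2 q2]) simp
  then show th: "\<theta> \<le> 1173/1000 * \<epsilon>\<^sup>2" using theta_le eps_powers(4) by argo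
  have "\<theta>\<^sup>2 / 2 \<le> 69/10000 * \<epsilon>\<^sup>2"
    by (rule theta_square_le[OF th]) simp
  with beta_le g th eps_powers(4) show "\<eta> \<le> 2351/1000 * \<epsilon>\<^sup>2" by argo
qed

lemma refined_bounds:
  "A \<le> 463/1000 * \<epsilon>" "r \<le> 2136/10000 * \<epsilon>\<^sup>2"
  "\<bar>\<omega> - omega_bar \<epsilon>\<bar> \<le> 286/10000 * \<epsilon>\<^sup>2" "\<bar>\<beta> - (1 - 3 * \<epsilon>\<^sup>2 / 5)\<bar> \<le> 308/10000 * \<epsilon>\<^sup>2"
proof -
  have e2: "\<epsilon>\<^sup>2 \<le> 1/100" using eps_powers(1) eps by linarith
  have T: "\<theta> \<le> 1173/100000" and H: "\<eta> \<le> 2351/100000" using coarse_bounds(3,4) e2 by argo+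
  have m3: "3882/1000 \<le> cmod (diag \<omega> \<beta> k)" if "3 \<le> k" for k
    using norm_diag_ge_quarter[OF that, of \<beta> \<omega>] H by argo
  have m2: "2188/1000 \<le> cmod (diag \<omega> \<beta> 2)" using norm_diag_2_ge_quarter[of \<beta> \<omega>] H by argo
  have B: "B \<le> r" using r_eq nonneg by linarith
  have s1: "s \<le> 597/1000 * \<epsilon>" and r1: "r \<le> 49/1000 * \<epsilon>"
    using s_eq coarse_bounds(1,2) eps_powers(1) by linarith+
  have r2: "r \<le> 274/1000 * \<epsilon>\<^sup>2"
    by (rule r_arith[OF _ m3 T coarse_bounds(1) r1 s1]) (simp_all add: power2_eq_square)
  have s2: "s \<le> 5754/10000 * \<epsilon>" using s_eq coarse_bounds(1) r2 eps_powers(1) by linarith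
  have "cmod (q 2) \<le> 6623/100000 * \<epsilon>"
    using norm_q_le[of 2] square_le_scaled(1)[OF nonneg(1) s2] eps by (simp add: power2_eq_square)
  then have "2 * B + cmod (q 2) \<le> 1211/100000" using B r2 e2 eps by linarith
  then show A: "A \<le> 463/1000 * \<epsilon>" by (rule A_arith[OF _ m2]) simp_all
  have s3: "s \<le> 4904/10000 * \<epsilon>" and r3: "r \<le> 274/10000 * \<epsilon>"
    using s_eq A r2 eps_powers(1) by linarith+
  show r: "r \<le> 2136/10000 * \<epsilon>\<^sup>2"
    by (rule r_arith[OF _ m3 T A r3 s3]) (simp_all add: power2_eq_square)
  have rA: "r \<le> 463/1000 * \<epsilon>" using r3 eps by linarith
  \<comment> \<open>The tail estimate replaces the crude bound 2 s^2, because
    \<open>g1_diff_arith\<close> asks for order \<epsilon>^3 in the quadratic term; 0.396 rounds up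
    4 * 0.2136 * 0.463.\<close>
  have q: "cmod (q k) \<le> 396/1000 * \<epsilon> ^ 3" if "k \<noteq> 4" for k
    using q_tail_le[OF A r rA that] eps_powers(5) by linarith
  have q': "cmod (q k) \<le> 396/10000 * \<epsilon>\<^sup>2" "cmod (q k) \<le> 396/100000 * \<epsilon>" if "k \<noteq> 4" for k
    using q[OF that] eps_powers by linarith+
  have g: "\<epsilon> * cmod (g 1) \<le> 676/1000 * \<epsilon>\<^sup>2"
    by (rule g1_arith[OF T A q'(2)]) simp_all
  then have th: "\<theta> \<le> 677/1000 * \<epsilon>\<^sup>2" using theta_le eps_powers(4) by argo
  have th2: "\<theta>\<^sup>2 / 2 \<le> 23/10000 * \<epsilon>\<^sup>2"
    by (rule theta_square_le[OF th]) simp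
  have H': "\<eta> \<le> 1356/1000 * \<epsilon>\<^sup>2" using beta_le g th th2 eps_powers(4) by argo
  have m2': "2208/1000 \<le> cmod (diag \<omega> \<beta> 2)" using norm_diag_2_ge_quarter[of \<beta> \<omega>] H' e2 by argo
  have B': "B \<le> 2136/10000 * \<epsilon>\<^sup>2" using B r by linarith
  have d: "cmod (c 2 - c2) \<le> 1068/1000 * \<epsilon> ^ 3"
    by (rule c2_arith[OF m2' _ th H' B' q'(1)]) simp_all
  have G: "\<epsilon> * cmod (g 1 - (\<i> - 1) * c2) \<le> (285/100) / 100 * \<epsilon>\<^sup>2"
    by (rule g1_diff_arith[OF th A d q]) simp_all
  have "\<theta>\<^sup>2 / 2 * \<theta> \<le> 23/10000 * \<epsilon>\<^sup>2 * (1/50)"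
    using th2 T by (intro mult_mono) auto
  with G frequency_error(1) eps_powers(4) show "\<bar>\<omega> - omega_bar \<epsilon>\<bar> \<le> 286/10000 * \<epsilon>\<^sup>2"
    by argo
  from G frequency_error(2) th2 show "\<bar>\<beta> - (1 - 3 * \<epsilon>\<^sup>2 / 5)\<bar> \<le> 308/10000 * \<epsilon>\<^sup>2"
    by argo
qed

lemma sharp_bounds:
  "\<bar>\<omega> - omega_bar \<epsilon>\<bar> \<le> 155/10000 * \<epsilon>\<^sup>2" "\<bar>\<beta> - (1 - 3 * \<epsilon>\<^sup>2 / 5)\<bar> \<le> 157/10000 * \<epsilon>\<^sup>2"
  "ell1_norm (\<lambda>k. c k - c_bar \<epsilon> k) \<le> 482/1000 * \<epsilon>\<^sup>2" "ell1_norm (opK_inv c) < 3/10"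
proof -
  have e2: "\<epsilon>\<^sup>2 \<le> 1/100" using eps_powers(1) eps by linarith
  \<comment> \<open>The exact second order terms are now known, so only the errors add to them:
    0.2286 = 0.2 + 0.0286 and 0.8594 = 0.2 + 0.6 + 0.0286 + 0.0308.\<close>
  have th: "\<theta> \<le> 2286/10000 * \<epsilon>\<^sup>2" and H: "\<eta> \<le> 8594/10000 * \<epsilon>\<^sup>2"
    using refined_bounds(3,4) eps_powers(4) unfolding omega_bar_def by argo+
  have T: "\<theta> \<le> 2286/1000000" using th e2 by argo
  have m3: "3957/1000 \<le> cmod (diag \<omega> \<beta> k)" if "3 \<le> k" for k
    using norm_diag_ge_quarter[OF that, of \<beta> \<omega>] H e2 by argo
  have m2: "2218/1000 \<le> cmod (diag \<omega> \<beta> 2)" using norm_diag_2_ge_quarter[of \<beta> \<omega>] H e2 by argo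
  have B: "B \<le> r" using r_eq nonneg by linarith
  have r0: "r \<le> 463/1000 * \<epsilon>" and r1: "r \<le> 2136/100000 * \<epsilon>" using refined_bounds(2) eps_powers(1) eps by linarith+
  have q0: "cmod (q k) \<le> 396/1000 * \<epsilon> ^ 3" if "k \<noteq> 4" for k
    using q_tail_le[OF refined_bounds(1,2) r0 that] eps_powers(5) by linarith
  have "2 * B + cmod (q 2) \<le> 468/100000" using q0[of 2] refined_bounds(2) B eps_powers(2) e2 by linarith
  then have A: "A \<le> 453/1000 * \<epsilon>" by (rule A_arith[OF _ m2]) simp_all
  have s1: "s \<le> 4744/10000 * \<epsilon>" using s_eq A r1 eps by linarith
  have r: "r \<le> 1957/10000 * \<epsilon>\<^sup>2"
    by (rule r_arith[OF _ m3 T A r1 s1]) (simp_all add: power2_eq_square)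
  have s2: "s \<le> 473/1000 * \<epsilon>" and rA: "r \<le> 453/1000 * \<epsilon>" using s_eq A r eps_powers(1) eps by linarith+
  have ss: "2 * s\<^sup>2 \<le> 4475/10000 * \<epsilon>\<^sup>2"
    using square_le_scaled(2)[OF nonneg(1) s2] eps zero_le_square[of \<epsilon>] unfolding power2_eq_square by linarith
  have B1: "B \<le> 1957/10000 * \<epsilon>\<^sup>2" using B r by linarith
  have R13: "cmod (exp (- \<i> * of_real \<omega>) + exp (- \<i> * 3 * of_real \<omega>)) \<le> 92/10000"
    using norm_exp_13_le[of \<omega>] T by argo
  \<comment> \<open>Used twice: with the bound that \<open>v\<close> inherits from \<open>r\<close>
    the term 4 v dominates the right-hand side, so a second pass with the output of the first more
    than halves the constant.\<close>
  note v_step = tail_arith[OF v_ineq[OF _ m3] order_refl _ _ eps(2) norm_ge_zero R13 norm_ge_zero B1 nonneg(3) _ ss]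
  have v0: "v \<le> 1957/10000 * \<epsilon>\<^sup>2" using r_eq r norm_ge_zero[of "c 3"] by linarith
  have v1: "v \<le> 3115/10000 * \<epsilon> ^ 3"
    by (rule v_step[OF _ _ _ _ v0]) (use eps in simp_all)
  have v2: "v \<le> 3115/100000 * \<epsilon>\<^sup>2" using v1 eps_powers(2) by linarith
  have v: "v \<le> 1451/10000 * \<epsilon> ^ 3"
    by (rule v_step[OF _ _ _ _ v2]) (use eps in simp_all)
  have q: "cmod (q k) \<le> 3547/10000 * \<epsilon> ^ 3" if "k \<noteq> 4" for k
    using q_tail_le[OF A r rA that] eps_powers(5) by linarith
  have q': "cmod (q k) \<le> 3547/100000 * \<epsilon>\<^sup>2" if "k \<noteq> 4" for k
    using q[OF that] eps_powers by linarith
  have P: "cmod (exp (- \<i> * of_real \<omega>) + exp (- \<i> * 2 * of_real \<omega>)) \<le> 14212/10000"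
    using norm_exp_12_le[of \<omega>] T by argo
  have PA: "cmod (exp (- \<i> * of_real \<omega>) + exp (- \<i> * 2 * of_real \<omega>)) * A \<le> 14212/10000 * (453/1000 * \<epsilon>)"
    by (rule mult_mono[OF P A]) auto
  \<comment> \<open>Treating component 3 alone replaces the 4 r + 2 s^2 of the tail estimate by 2 v
    + |q 3|, which is of order \<epsilon>^3. The constant drops from 0.1957 to 0.1644, close to the
    leading value sqrt 2 / (4 sqrt 5).\<close>
  have B2: "B \<le> 1644/10000 * \<epsilon>\<^sup>2"
  proof (rule le_of_mult_le[OF B_ineq m3])
    have "cmod (exp (- \<i> * of_real \<omega>) + exp (- \<i> * 2 * of_real \<omega>)) * A + (2 * v + cmod (q 3)) \<le> 6503/10000 * \<epsilon> ^ 1"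
      using PA v q[of 3] eps_powers eps by simp
    from times_eps[OF this]
    have "\<epsilon> * (cmod (exp (- \<i> * of_real \<omega>) + exp (- \<i> * 2 * of_real \<omega>)) * A + (2 * v + cmod (q 3)))
      \<le> 6503/10000 * \<epsilon>\<^sup>2"
      by (simp add: power2_eq_square)
    with eps_powers(4) show "\<epsilon> * (cmod (exp (- \<i> * of_real \<omega>) + exp (- \<i> * 2 * of_real \<omega>)) * A + (2 * v + cmod (q 3)))
      \<le> 3957/1000 * (1644/10000 * \<epsilon>\<^sup>2)"
      by linarith
  qed simp_all
  have d: "cmod (c 2 - c2) \<le> 614/1000 * \<epsilon> ^ 3"
    by (rule c2_arith[OF m2 _ th H B2 q']) simp_all
  have G: "\<epsilon> * cmod (g 1 - (\<i> - 1) * c2) \<le> (1534/1000) / 100 * \<epsilon>\<^sup>2"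
    by (rule g1_diff_arith[OF th A d q]) simp_all
  have th2: "\<theta>\<^sup>2 / 2 \<le> 3/10000 * \<epsilon>\<^sup>2"
    by (rule theta_square_le[OF th]) simp
  have "\<theta>\<^sup>2 / 2 * \<theta> \<le> 3/10000 * \<epsilon>\<^sup>2 * (1/100)"
    using th2 T by (intro mult_mono) auto
  with G frequency_error(1) eps_powers(4) show "\<bar>\<omega> - omega_bar \<epsilon>\<bar> \<le> 155/10000 * \<epsilon>\<^sup>2"
    by argo
  from G frequency_error(2) th2 eps_powers(4) show "\<bar>\<beta> - (1 - 3 * \<epsilon>\<^sup>2 / 5)\<bar> \<le> 157/10000 * \<epsilon>\<^sup>2"
    by argo
  have cb: "(\<lambda>k. c k - c_bar \<epsilon> k) = (\<lambda>k. (c 2 - c2) * unit_seq 2 k + tail_seq 3 c k)"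
    using bx(4,5) by (auto simp: fun_eq_iff c_bar_def c2_def tail_seq_def unit_seq_def numeral_3_eq_3 numeral_2_eq_2 less_Suc_eq)
  have um: "(\<lambda>k. (c 2 - c2) * unit_seq 2 k) \<in> ell1" "ell1_norm (\<lambda>k. (c 2 - c2) * unit_seq 2 k) = 2 * cmod (c 2 - c2)"
    using ell1_unit[of 2 "c 2 - c2"] by simp_all
  \<comment> \<open>In units of \<epsilon>^2 and at \<epsilon> = 1/10, the error of
    \<open>c 2\<close>, component 3 and the tail \<open>v\<close> contribute about 0.123, 0.329 and
    0.029.\<close>
  have "ell1_norm (\<lambda>k. c k - c_bar \<epsilon> k) \<le> 2 * cmod (c 2 - c2) + 2 * r"
    unfolding cb using ell1_add(2)[OF um(1) ell1_cut(1)[OF bx(3), of 3]] um(2) by simp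
  with d B2 v r_eq eps_powers show "ell1_norm (\<lambda>k. c k - c_bar \<epsilon> k) \<le> 482/1000 * \<epsilon>\<^sup>2" by linarith
  have "ell1_norm (tail_seq 3 (opK_inv c)) \<le> (8/5 * \<epsilon>) * ell1_norm (tail_seq 3 g)"
  proof (rule ell1_norm_cut_dominated[of g "opK_inv c", OF ell1_nlin(1)[OF bx(3)]])
    fix k :: nat assume k: "3 \<le> k"
    have "cmod (opK_inv c k) = k * cmod (c k)" by (simp add: opK_inv_def norm_mult)
    also have "\<dots> \<le> 8/5 * cmod (diag \<omega> \<beta> k) * cmod (c k)"
      by (rule mult_right_mono[OF norm_diag_ge_in_box(1)[OF in_box]]) (use k in auto)
    also have "cmod (diag \<omega> \<beta> k) * cmod (c k) = \<epsilon> * cmod (g k)"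
      using arg_cong[OF diag_mult_eq[of k], of cmod] k eps by (simp add: norm_mult)
    then have "8/5 * cmod (diag \<omega> \<beta> k) * cmod (c k) = 8/5 * \<epsilon> * cmod (g k)" by simp
    finally show "cmod (opK_inv c k) \<le> (8/5 * \<epsilon>) * cmod (g k)" .
  qed (simp add: opK_inv_def)
  also have "\<dots> \<le> (8/50) * (16/10 * \<epsilon>)"
  proof (rule mult_mono)
    have "ell1_norm (tail_seq 3 g)
      \<le> 2 * (cmod (exp (- \<i> * of_real \<omega>) + exp (- \<i> * 2 * of_real \<omega>)) * A) + 8 * r + 4 * s\<^sup>2"
      using nlin_tail[of 2] by (simp add: power2_eq_square)
    with PA ss r eps_powers(1) eps show "ell1_norm (tail_seq 3 g) \<le> 16/10 * \<epsilon>" by linarith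
  qed (use eps in \<open>auto simp: ell1_norm_nonneg\<close>)
  finally have K3: "ell1_norm (tail_seq 3 (opK_inv c)) \<le> 256/1000 * \<epsilon>" by simp
  have "tail_seq 2 (opK_inv c) = opK_inv c"
    using bx(5) by (auto simp: tail_seq_def fun_eq_iff opK_inv_def less_2_cases_iff)
  then have "ell1_norm (opK_inv c) = 4 * A + ell1_norm (tail_seq 3 (opK_inv c))"
    using ell1_norm_cut_Suc[OF bx(6), of 2] by (simp add: opK_inv_def norm_mult numeral_3_eq_3 numeral_2_eq_2)
  with A K3 eps show "ell1_norm (opK_inv c) < 3/10" by linarith
qed

end

section \<open>The main theorem\<close>

lemma pi_bounds: "314/100 \<le> pi" "pi \<le> 315/100"
  using pi_approx by simp_all

lemma alpha_bar_gap: "7/10 * \<epsilon>\<^sup>2 \<le> alpha_bar \<epsilon> - pi / 2" "alpha_bar \<epsilon> - pi / 2 \<le> 745/1000 * \<epsilon>\<^sup>2"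
proof -
  have "7/10 * \<epsilon>\<^sup>2 \<le> (3 * pi / 2 - 1) / 5 * \<epsilon>\<^sup>2" "(3 * pi / 2 - 1) / 5 * \<epsilon>\<^sup>2 \<le> 745/1000 * \<epsilon>\<^sup>2"
    using pi_bounds by (intro mult_right_mono; simp)+
  then show "7/10 * \<epsilon>\<^sup>2 \<le> alpha_bar \<epsilon> - pi / 2" "alpha_bar \<epsilon> - pi / 2 \<le> 745/1000 * \<epsilon>\<^sup>2"
    by (simp_all add: alpha_bar_def mult.commute)
qed

lemma (in fixed_point) alpha_error: "\<bar>\<omega> / \<beta> - alpha_bar \<epsilon>\<bar> \<le> 50/1000 * \<epsilon>\<^sup>2"
proof -
  define a where "a = alpha_bar \<epsilon>"
  define d1 where "d1 = \<omega> - omega_bar \<epsilon>"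
  define d2 where "d2 = \<beta> - (1 - 3 * \<epsilon>\<^sup>2 / 5)"
  have d: "\<bar>d1\<bar> \<le> 155/10000 * \<epsilon>\<^sup>2" "\<bar>d2\<bar> \<le> 157/10000 * \<epsilon>\<^sup>2"
    using sharp_bounds(1,2) by (simp_all add: d1_def d2_def)
  have b: "965/1000 \<le> \<beta>" using bx(2) by argo
  have a: "0 \<le> a" "a \<le> 1583/1000"
    using alpha_bar_gap[of \<epsilon>] pi_bounds eps_powers(1,4) eps unfolding a_def by linarith+
  \<comment> \<open>\<open>alpha_bar\<close> is the second order expansion of
    \<open>omega_bar\<close> / (1 - 3 \<epsilon>^2 / 5), so apart from the errors \<open>d1\<close>
    and \<open>d2\<close> only a term of order \<epsilon>^4 survives. Multiplying by \<beta> avoids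
    expanding the quotient.\<close>
  have eq: "\<omega> - a * \<beta> = d1 + 3/5 * ((a - pi / 2) * \<epsilon>\<^sup>2) - a * d2"
  proof -
    have "a * \<beta> = a * d2 + a - 3/5 * (a * \<epsilon>\<^sup>2)" by (simp add: d2_def algebra_simps)
    moreover have "\<omega> = d1 + pi / 2 - \<epsilon>\<^sup>2 / 5" by (simp add: d1_def omega_bar_def)
    moreover have "a = pi / 2 + 3/5 * (pi / 2 * \<epsilon>\<^sup>2) - \<epsilon>\<^sup>2 / 5"
      by (simp add: a_def alpha_bar_def algebra_simps)
    ultimately show ?thesis unfolding left_diff_distrib by argo
  qed
  have "(a - pi / 2) * \<epsilon>\<^sup>2 \<le> (745/1000 * \<epsilon>\<^sup>2) * (1/100)"
    using alpha_bar_gap[of \<epsilon>] eps_powers(1,4) eps unfolding a_def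
    by (intro mult_mono) auto
  moreover have "0 \<le> (a - pi / 2) * \<epsilon>\<^sup>2"
  proof (rule mult_nonneg_nonneg[OF _ eps_powers(4)])
    show "0 \<le> a - pi / 2" using alpha_bar_gap(1)[of \<epsilon>] eps_powers(4) unfolding a_def by linarith
  qed
  moreover have "\<bar>a * d2\<bar> \<le> 1583/1000 * (157/10000 * \<epsilon>\<^sup>2)"
    unfolding abs_mult using a d(2) by (intro mult_mono) auto
  ultimately have "\<bar>\<omega> - a * \<beta>\<bar> \<le> 449/10000 * \<epsilon>\<^sup>2"
    unfolding eq using d(1) eps_powers(4) by argo
  also have "\<dots> \<le> 965/1000 * (50/1000 * \<epsilon>\<^sup>2)" by simp
  also have "\<dots> \<le> \<beta> * (50/1000 * \<epsilon>\<^sup>2)" using b by (intro mult_right_mono) auto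
  finally have "\<bar>\<omega> - a * \<beta>\<bar> \<le> \<beta> * (50/1000 * \<epsilon>\<^sup>2)" .
  moreover have "\<omega> / \<beta> - a = (\<omega> - a * \<beta>) / \<beta>" using b by (simp add: field_simps)
  ultimately show ?thesis using b unfolding a_def[symmetric] by (simp add: abs_divide divide_le_eq mult.commute)
qed

text \<open>Every candidate of the theorem, rewritten with \<beta> = \<omega> / \<alpha>, lies well
  inside the box, so uniqueness there is uniqueness among all candidates. The radii 6/100 and 3/100
  are rounded up from those of the theorem.\<close>

lemma fixed_point_of_solution:
  assumes eps: "0 < \<epsilon>" "\<epsilon> \<le> 1/10"
    and c: "c \<in> ellK_0" "ell1_norm (opK_inv c) \<le> 1/2"
    and F: "F_op \<epsilon> (\<alpha>, \<omega>, c) = (\<lambda>k. 0)"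
    and a: "\<bar>\<alpha> - alpha_bar \<epsilon>\<bar> \<le> 6/100 * \<epsilon>\<^sup>2" and w: "\<bar>\<omega> - omega_bar \<epsilon>\<bar> \<le> 3/100 * \<epsilon>\<^sup>2"
  shows "pi / 2 < \<alpha>" "0 < \<omega>" "(\<omega>, \<omega> / \<alpha>, c) \<in> search_box" "picard_step \<epsilon> (\<omega>, \<omega> / \<alpha>, c) = (\<omega>, \<omega> / \<alpha>, c)"
proof -
  have e2: "0 < \<epsilon>\<^sup>2" "\<epsilon>\<^sup>2 \<le> 1/100"
    using eps power_mono[OF eps(2), of 2] by (simp_all add: power2_eq_square)
  show alpha: "pi / 2 < \<alpha>" using alpha_bar_gap(1)[of \<epsilon>] a e2 by argo
  then have alpha': "157/100 \<le> \<alpha>" using pi_bounds by simp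
  have w1: "\<bar>\<omega> - pi / 2\<bar> \<le> 23/10000" using w e2 unfolding omega_bar_def by argo
  then show "0 < \<omega>" using pi_bounds by argo
  have "\<bar>\<omega> - \<alpha>\<bar> \<le> 1/50" using alpha_bar_gap[of \<epsilon>] a w1 e2 by argo
  moreover have "1/50 \<le> \<alpha> * (35/1000)" using alpha' by simp
  ultimately have "\<bar>\<omega> - \<alpha>\<bar> \<le> \<alpha> * (35/1000)" by argo
  moreover have "\<omega> / \<alpha> - 1 = (\<omega> - \<alpha>) / \<alpha>" using alpha' by (simp add: field_simps)
  ultimately have "\<bar>\<omega> / \<alpha> - 1\<bar> \<le> 35/1000"
    using alpha' by (simp add: abs_divide divide_le_eq mult.commute)
  with w1 c show bx: "(\<omega>, \<omega> / \<alpha>, c) \<in> search_box" by (simp add: search_box_def)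
  from F_op_eq_0_iff[OF bx, of \<alpha> \<epsilon>] F alpha'
  show "picard_step \<epsilon> (\<omega>, \<omega> / \<alpha>, c) = (\<omega>, \<omega> / \<alpha>, c)" by simp
qed

theorem proposition3p15:
  fixes \<epsilon>0 r\<alpha> r\<omega> rc \<rho> :: real
    and Sol :: "real \<Rightarrow> (real \<times> real \<times> (nat \<Rightarrow> complex)) set"
  assumes "\<epsilon>0 = 0.10"
    and "r\<alpha> = 0.0594" and "r\<omega> = 0.0260" and "rc = 0.4929"
    and "\<rho> = 0.3191"
    and "\<And>\<epsilon>. Sol \<epsilon> = {(\<alpha>, \<omega>, c). c \<in> ellK_0 \<and> F_op \<epsilon> (\<alpha>, \<omega>, c) = (\<lambda>k. 0) \<and>
           \<bar>\<alpha> - alpha_bar \<epsilon>\<bar> < r\<alpha> * \<epsilon>\<^sup>2 \<and>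
           \<bar>\<omega> - omega_bar \<epsilon>\<bar> < r\<omega> * \<epsilon>\<^sup>2 \<and>
           ell1_norm (\<lambda>k. c k - c_bar \<epsilon> k) < rc * \<epsilon>\<^sup>2 \<and>
           ell1_norm (opK_inv c) < \<rho>}"
  shows "(\<forall>\<epsilon>. 0 < \<epsilon> \<and> \<epsilon> \<le> \<epsilon>0 \<longrightarrow> (\<exists>!x. x \<in> Sol \<epsilon>)) \<and>
         (\<forall>\<epsilon>. 0 < \<epsilon> \<and> \<epsilon> < \<epsilon>0 \<longrightarrow> (\<forall>(\<alpha>, \<omega>, c) \<in> Sol \<epsilon>. \<alpha> > pi / 2))"
proof -
  have sol: "pi / 2 < \<alpha>" "0 < \<omega>" "(\<omega>, \<omega> / \<alpha>, c) \<in> search_box" "picard_step \<epsilon> (\<omega>, \<omega> / \<alpha>, c) = (\<omega>, \<omega> / \<alpha>, c)"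
    if "(\<alpha>, \<omega>, c) \<in> Sol \<epsilon>" "0 < \<epsilon>" "\<epsilon> \<le> 1/10" for \<epsilon> \<alpha> \<omega> c
  proof -
    have e2: "0 \<le> \<epsilon>\<^sup>2" by simp
    have *: "c \<in> ellK_0" "F_op \<epsilon> (\<alpha>, \<omega>, c) = (\<lambda>k. 0)"
      "\<bar>\<alpha> - alpha_bar \<epsilon>\<bar> < 594/10000 * \<epsilon>\<^sup>2" "\<bar>\<omega> - omega_bar \<epsilon>\<bar> < 260/10000 * \<epsilon>\<^sup>2" "ell1_norm (opK_inv c) < 3191/10000"
      using that(1) by (simp_all add: assms)
    have "ell1_norm (opK_inv c) \<le> 1/2" using *(5) by simp
    moreover have "\<bar>\<alpha> - alpha_bar \<epsilon>\<bar> \<le> 6/100 * \<epsilon>\<^sup>2" "\<bar>\<omega> - omega_bar \<epsilon>\<bar> \<le> 3/100 * \<epsilon>\<^sup>2"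
      using *(3,4) e2 by argo+
    ultimately show "pi / 2 < \<alpha>" "0 < \<omega>" "(\<omega>, \<omega> / \<alpha>, c) \<in> search_box" "picard_step \<epsilon> (\<omega>, \<omega> / \<alpha>, c) = (\<omega>, \<omega> / \<alpha>, c)"
      using fixed_point_of_solution[OF that(2,3) *(1) _ *(2)] by blast+
  qed
  have "\<exists>!x. x \<in> Sol \<epsilon>" if e: "0 < \<epsilon>" "\<epsilon> \<le> 1/10" for \<epsilon>
  proof (rule ex_ex1I)
    obtain \<omega> \<beta> c where mem: "(\<omega>, \<beta>, c) \<in> search_box" and fp: "picard_step \<epsilon> (\<omega>, \<beta>, c) = (\<omega>, \<beta>, c)"
      using step_fixpoint_exists[of \<epsilon>] e by auto
    interpret fixed_point \<epsilon> \<omega> \<beta> c by unfold_locales (use mem fp e in auto)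
    have "0 < \<omega>" "0 < \<beta>" using boxD(1,2)[OF mem] pi_bounds by argo+
    then have F: "F_op \<epsilon> (\<omega> / \<beta>, \<omega>, c) = (\<lambda>k. 0)"
      using F_op_eq_0_iff[OF mem, of "\<omega> / \<beta>" \<epsilon>] fp by simp
    have "0 < \<epsilon>\<^sup>2" using e by simp
    then have "\<bar>\<omega> / \<beta> - alpha_bar \<epsilon>\<bar> < 594/10000 * \<epsilon>\<^sup>2" "\<bar>\<omega> - omega_bar \<epsilon>\<bar> < 260/10000 * \<epsilon>\<^sup>2"
      "ell1_norm (\<lambda>k. c k - c_bar \<epsilon> k) < 4929/10000 * \<epsilon>\<^sup>2"
      using alpha_error sharp_bounds(1,3) by argo+
    moreover have "ell1_norm (opK_inv c) < 3191/10000" using sharp_bounds(4) by simp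
    moreover have "c \<in> ellK_0" using mem by (simp add: search_box_def)
    ultimately have "(\<omega> / \<beta>, \<omega>, c) \<in> Sol \<epsilon>" using F by (simp add: assms)
    then show "\<exists>x. x \<in> Sol \<epsilon>" by blast
  next
    fix x y assume xy: "x \<in> Sol \<epsilon>" "y \<in> Sol \<epsilon>"
    obtain \<alpha> \<omega> c where x: "x = (\<alpha>, \<omega>, c)" by (cases x)
    obtain \<alpha>' \<omega>' c' where y: "y = (\<alpha>', \<omega>', c')" by (cases y)
    note sx = sol[OF xy(1)[unfolded x] e] and sy = sol[OF xy(2)[unfolded y] e]
    have "(\<omega>, \<omega> / \<alpha>, c) = (\<omega>', \<omega>' / \<alpha>', c')"
      by (rule step_fixpoint_unique[OF _ e(2) sx(3) sy(3) sx(4) sy(4)]) (use e in simp)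
    \<comment> \<open>Since \<omega> is positive, \<alpha> can be recovered from \<omega> /
      \<alpha>.\<close>
    moreover have "\<alpha> \<noteq> 0" "\<alpha>' \<noteq> 0" using sx(1) sy(1) pi_gt_zero by auto
    ultimately show "x = y" using sx(2) by (auto simp: x y frac_eq_eq mult.commute[of _ \<alpha>])
  qed
  with sol show ?thesis by (auto simp: assms(1))
qed

end
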